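(* Let $G$ be a finite solvable group such that every quotient of $G$ has property $( * )$. Let $p_1,\ldots,p_n$ be distinct primes and, for each $i$, let $P_i$ be a Sylow $p_i$-subgroup of $G$. Then there exists $x\in G$ such that, for all $i=1,\ldots,n$, the subgroup $P_i\cap P_i^x$ is inclusion-minimal in the set $\{P_i\cap P_i^g : g\in G\}$.
   Context: For a subgroup $P\le G$ and $g\in G$, $P^g=g^{-1}Pg$. For a prime $p$, $O_p(G)$ denotes the intersection of all Sylow $p$-subgroups of $G$. A finite group $G$ has $( * )_p$ if there exist two Sylow $p$-subgroups of $G$ (not necessarily distinct) whose intersection is $O_p(G)$; $G$ has $( * )$ if it has $( * )_p$ for every prime $p$. "Every quotient of $G$" means $G/N$ for every normal subgroup $N$ of $G$ (including $G$ itself). *)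

theory Defs
  imports "HOL-Algebra.Algebra"
begin

text \<open>These notions are meant for finite groups \<open>G\<close> and primes \<open>p\<close> only: for infinite \<open>G\<close>,
  \<^term>\<open>order G\<close> is \<open>0\<close>. A prime that does not divide the group order is allowed;
  its Sylow subgroup is then the trivial one.\<close>

definition sylow_subgroup :: "('a, 'b) monoid_scheme \<Rightarrow> nat \<Rightarrow> 'a set \<Rightarrow> bool" where
  "sylow_subgroup G p P \<longleftrightarrow> subgroup P G \<and> card P = p ^ multiplicity p (order G)"

definition p_core :: "('a, 'b) monoid_scheme \<Rightarrow> nat \<Rightarrow> 'a set" where
  "p_core G p = \<Inter>{P. sylow_subgroup G p P}"

definition conj_subgroup :: "('a, 'b) monoid_scheme \<Rightarrow> 'a set \<Rightarrow> 'a \<Rightarrow> 'a set" where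
  "conj_subgroup G P g = (inv\<^bsub>G\<^esub> g <#\<^bsub>G\<^esub> P) #>\<^bsub>G\<^esub> g"

definition star_prop_at :: "('a, 'b) monoid_scheme \<Rightarrow> nat \<Rightarrow> bool" where
  "star_prop_at G p \<longleftrightarrow>
     (\<exists>P Q. sylow_subgroup G p P \<and> sylow_subgroup G p Q \<and> P \<inter> Q = p_core G p)"

definition star_prop :: "('a, 'b) monoid_scheme \<Rightarrow> bool" where
  "star_prop G \<longleftrightarrow> (\<forall>p. Factorial_Ring.prime p \<longrightarrow> star_prop_at G p)"

definition inclusion_minimal :: "'a set \<Rightarrow> 'a set set \<Rightarrow> bool" where
  "inclusion_minimal M S \<longleftrightarrow> M \<in> S \<and> (\<forall>A\<in>S. A \<subseteq> M \<longrightarrow> A = M)"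

end

theory Submission
  imports Defs
begin

text \<open>All intersections \<open>P i \<inter> P i\<^sup>x\<close> contain the core of \<open>P i\<close>, and the star property
  says that each core is attained, so the task is to attain all cores with one \<open>x\<close>. This is done by lifting \<open>x\<close> from \<open>G/L\<close> to \<open>G/K\<close>,
  where \<open>V = L/K\<close> is a minimal normal subgroup of \<open>G/K\<close>, hence abelian. Only the
  \<open>p i\<close>-groups \<open>S i = P i \<inter> core (P i V)\<close> with \<open>p i\<close> not dividing \<open>|V|\<close> matter. They act on \<open>V\<close>, and
  the actions of different \<open>S i\<close> commute. Correcting \<open>x\<close> by \<open>f \<in> V\<close> turns \<open>S i \<inter> S i\<^sup>x\<close> into the
  centralizer of \<open>f y i\<close> in \<open>S i\<close>, where \<open>y i \<in> V\<close> is prescribed, while the star property provides \<open>z i \<in> V\<close>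
  whose centralizer in \<open>S i\<close> is the core. So one needs \<open>f\<close> such that \<open>C(f y i) \<subseteq> C(z i)\<close> for all \<open>i\<close>.

  By Clifford's theorem \<open>V\<close> is a sum of irreducible modules for the \<open>S i\<close>, and \<open>f\<close> may be chosen separately
  in each summand. In the irreducible case let \<open>B i\<close> be the ring of endomorphisms commuting with \<open>S i\<close>
  and with fixed central elements \<open>c j \<in> S j\<close>. A count on a simple \<open>B i\<close>-module shows that less than one
  \<open>n\<close>-th of the elements of \<open>B i\<close> are not units, \<open>n\<close> being the number of groups. If \<open>V\<close> is a cyclic
  \<open>B i\<close>-module for each \<open>i\<close>, less than one \<open>n\<close>-th of all \<open>f\<close> are bad for \<open>i\<close>. If it is not
  cyclic for some \<open>i\<close>, then \<open>z i\<close> lies in a free cyclic submodule \<open>B i w\<close>, and \<open>f y i = u w\<close> works as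
  soon as \<open>n\<close> translates of \<open>u \<in> B i\<close>, one for each group, are units.\<close>

lemma (in group) mult_inv_eq_one_iff:
  assumes "x \<in> carrier G" "y \<in> carrier G"
  shows "x \<otimes> inv y = \<one> \<longleftrightarrow> x = y"
  using assms inv_equality[of x "inv y"] by auto

lemma (in comm_group) hom_equalizer_subgroup:
  assumes "s \<in> hom G G" "t \<in> hom G G"
  shows "subgroup {v \<in> carrier G. s v = t v} G"
proof -
  interpret s: group_hom G G s using assms(1) by unfold_locales
  interpret t: group_hom G G t using assms(2) by unfold_locales
  show ?thesis by (rule subgroupI) (auto intro!: exI[of _ \<one>])
qed

subsection \<open>Commuting groups acting irreducibly on an abelian group\<close>

text \<open>Abstract form of one irreducible summand of \<open>V\<close>. In the application
  \<open>S j\<close> consists of the conjugation maps of a \<open>p j\<close>-group, and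
  \<open>J\<close> collects the indices with nontrivial action, which is what makes the
  \<open>c j\<close> available. Irreducibility is joint: a single \<open>S i\<close> may well leave
  proper subgroups invariant.\<close>

locale commuting_automorphisms = comm_group +
  fixes J :: "'i set" and S :: "'i \<Rightarrow> ('a \<Rightarrow> 'a) set" and c :: "'i \<Rightarrow> 'a \<Rightarrow> 'a"
  assumes fin: "finite (carrier G)"
    and fin_J: "finite J"
    and nontriv: "carrier G \<noteq> {\<one>}"
    and S_hom: "\<lbrakk>j \<in> J; s \<in> S j\<rbrakk> \<Longrightarrow> s \<in> hom G G"
    and S_inj: "\<lbrakk>j \<in> J; s \<in> S j; v \<in> carrier G; s v = \<one>\<rbrakk> \<Longrightarrow> v = \<one>"
    and S_comm: "\<lbrakk>j \<in> J; k \<in> J; j \<noteq> k; s \<in> S j; t \<in> S k; v \<in> carrier G\<rbrakk> \<Longrightarrow> s (t v) = t (s v)"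
    and c_S: "j \<in> J \<Longrightarrow> c j \<in> S j"
    and c_central: "\<lbrakk>j \<in> J; s \<in> S j; v \<in> carrier G\<rbrakk> \<Longrightarrow> s (c j v) = c j (s v)"
    and c_nontriv: "j \<in> J \<Longrightarrow> \<exists>v\<in>carrier G. c j v \<noteq> v"
    and c_distinct: "\<lbrakk>j \<in> J; k \<in> J; j \<noteq> k\<rbrakk> \<Longrightarrow> \<exists>v\<in>carrier G. c j v \<noteq> c k v"
    and irreducible: "\<lbrakk>subgroup U G; \<And>j s u. \<lbrakk>j \<in> J; s \<in> S j; u \<in> U\<rbrakk> \<Longrightarrow> s u \<in> U\<rbrakk>
      \<Longrightarrow> U = {\<one>} \<or> U = carrier G"
begin

section \<open>Consequences of joint irreducibility for the central elements\<close>

lemma S_closed: "\<lbrakk>j \<in> J; s \<in> S j; v \<in> carrier G\<rbrakk> \<Longrightarrow> s v \<in> carrier G"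
  using S_hom by (auto simp: hom_def)

lemma S_mult: "\<lbrakk>j \<in> J; s \<in> S j; v \<in> carrier G; w \<in> carrier G\<rbrakk> \<Longrightarrow> s (v \<otimes> w) = s v \<otimes> s w"
  using S_hom by (auto simp: hom_def)

lemma S_group_hom: "\<lbrakk>j \<in> J; s \<in> S j\<rbrakk> \<Longrightarrow> group_hom G G s"
  using S_hom by (simp add: group_hom_def group_hom_axioms_def)

lemma c_all: "\<lbrakk>j \<in> J; k \<in> J; s \<in> S k; v \<in> carrier G\<rbrakk> \<Longrightarrow> s (c j v) = c j (s v)"
  by (cases "j = k") (simp_all add: c_central, metis S_comm c_S)

text \<open>By \<open>c_all\<close> the map \<open>c j\<close> commutes with every acting map, so
  its fixed points form an invariant subgroup; irreducibility and \<open>c_nontriv\<close> force it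
  to be trivial.\<close>

lemma c_fixes_only_one:
  assumes "j \<in> J" "v \<in> carrier G" "c j v = v"
  shows "v = \<one>"
proof -
  let ?U = "{v \<in> carrier G. c j v = id v}"
  have "subgroup ?U G"
    by (rule hom_equalizer_subgroup) (use assms S_hom c_S in \<open>auto simp: hom_def\<close>)
  moreover have "s u \<in> ?U" if "k \<in> J" "s \<in> S k" "u \<in> ?U" for k s u
    using that assms by (auto simp: S_closed c_all[symmetric])
  ultimately have "?U = {\<one>} \<or> ?U = carrier G" by (rule irreducible)
  moreover have "?U \<noteq> carrier G" using c_nontriv[OF assms(1)] by auto
  ultimately show ?thesis using assms by auto
qed

text \<open>The same argument for the equalizer of two central maps. Both facts serve to keep the
  kernel elements counted in \<open>card_singulars\<close> apart.\<close>

lemma c_agree_only_one: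
  assumes "j \<in> J" "k \<in> J" "j \<noteq> k" "v \<in> carrier G" "c j v = c k v"
  shows "v = \<one>"
proof -
  let ?U = "{v \<in> carrier G. c j v = c k v}"
  have "subgroup ?U G"
    by (rule hom_equalizer_subgroup) (use assms S_hom c_S in auto)
  moreover have "s u \<in> ?U" if "l \<in> J" "s \<in> S l" "u \<in> ?U" for l s u
    using that assms by (auto simp: S_closed c_all[symmetric])
  ultimately have "?U = {\<one>} \<or> ?U = carrier G" by (rule irreducible)
  moreover have "?U \<noteq> carrier G" using c_distinct[OF assms(1-3)] by auto
  ultimately show ?thesis using assms by auto
qed

text \<open>The ring \<open>B i\<close>. It contains all \<open>S j\<close> with \<open>j \<noteq> i\<close>; commuting with the \<open>c j\<close> makes the kernels
  of its elements large.\<close>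

definition cent :: "'i \<Rightarrow> ('a \<Rightarrow> 'a) set" where
  "cent i = {b \<in> hom G G. b \<in> extensional (carrier G) \<and>
     (\<forall>s\<in>S i \<union> c ` (J - {i}). \<forall>v\<in>carrier G. b (s v) = s (b v))}"

definition submod :: "'i \<Rightarrow> 'a set \<Rightarrow> bool" where
  "submod i U \<longleftrightarrow> subgroup U G \<and> (\<forall>b\<in>cent i. \<forall>u\<in>U. b u \<in> U)"

definition minimal_submod :: "'i \<Rightarrow> 'a set \<Rightarrow> bool" where
  "minimal_submod i T \<longleftrightarrow> submod i T \<and> T \<noteq> {\<one>} \<and>
     (\<forall>U. submod i U \<longrightarrow> U \<subseteq> T \<longrightarrow> U = {\<one>} \<or> U = T)"

definition cyc :: "'i \<Rightarrow> 'a \<Rightarrow> 'a set" where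
  "cyc i z = (\<lambda>b. b z) ` cent i"

text \<open>Ring addition on \<open>cent i\<close>. Restricting to the carrier keeps results in
  \<open>extensional\<close>, so that ring elements are equal as soon as they agree on the carrier,
  and the ring is finite.\<close>

definition plus :: "('a \<Rightarrow> 'a) \<Rightarrow> ('a \<Rightarrow> 'a) \<Rightarrow> 'a \<Rightarrow> 'a" where
  "plus a b = (\<lambda>v\<in>carrier G. a v \<otimes> b v)"

definition neg :: "('a \<Rightarrow> 'a) \<Rightarrow> 'a \<Rightarrow> 'a" where
  "neg a = (\<lambda>v\<in>carrier G. inv (a v))"

section \<open>Arithmetic of the centralizer rings\<close>

lemma plus_apply [simp]: "v \<in> carrier G \<Longrightarrow> plus a b v = a v \<otimes> b v"
  by (simp add: plus_def)

lemma neg_apply [simp]: "v \<in> carrier G \<Longrightarrow> neg a v = inv (a v)"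
  by (simp add: neg_def)

lemma cent_hom: "b \<in> cent i \<Longrightarrow> b \<in> hom G G"
  by (simp add: cent_def)

lemma cent_group_hom: "b \<in> cent i \<Longrightarrow> group_hom G G b"
  by (simp add: cent_def group_hom_def group_hom_axioms_def)

lemma cent_closed [simp]: "\<lbrakk>b \<in> cent i; v \<in> carrier G\<rbrakk> \<Longrightarrow> b v \<in> carrier G"
  using hom_in_carrier[OF cent_hom] by blast

lemma cent_mult: "\<lbrakk>b \<in> cent i; v \<in> carrier G; w \<in> carrier G\<rbrakk> \<Longrightarrow> b (v \<otimes> w) = b v \<otimes> b w"
  using hom_mult[OF cent_hom] by blast

lemma cent_one [simp]: "b \<in> cent i \<Longrightarrow> b \<one> = \<one>"
  by (rule group_hom.hom_one[OF cent_group_hom])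

lemma cent_inv: "\<lbrakk>b \<in> cent i; v \<in> carrier G\<rbrakk> \<Longrightarrow> b (inv v) = inv (b v)"
  by (rule group_hom.hom_inv[OF cent_group_hom])

lemma cent_commute_S: "\<lbrakk>b \<in> cent i; s \<in> S i; v \<in> carrier G\<rbrakk> \<Longrightarrow> b (s v) = s (b v)"
  unfolding cent_def by blast

text \<open>The index \<open>j = i\<close> is covered because \<open>c i\<close> lies in
  \<open>S i\<close>.\<close>

lemma cent_commute_c: "\<lbrakk>i \<in> J; b \<in> cent i; j \<in> J; v \<in> carrier G\<rbrakk> \<Longrightarrow> b (c j v) = c j (b v)"
  using cent_commute_S[OF _ c_S, of b i v] unfolding cent_def by blast

lemma cent_eqI:
  assumes "a \<in> cent i" "b \<in> cent i" "\<And>v. v \<in> carrier G \<Longrightarrow> a v = b v"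
  shows "a = b"
  using assms unfolding cent_def by (blast intro: extensionalityI)

lemma centI:
  assumes "b \<in> carrier G \<rightarrow> carrier G" "b \<in> extensional (carrier G)"
    and "\<And>v w. \<lbrakk>v \<in> carrier G; w \<in> carrier G\<rbrakk> \<Longrightarrow> b (v \<otimes> w) = b v \<otimes> b w"
    and "\<And>s v. \<lbrakk>s \<in> S i; v \<in> carrier G\<rbrakk> \<Longrightarrow> b (s v) = s (b v)"
    and "\<And>j v. \<lbrakk>j \<in> J; j \<noteq> i; v \<in> carrier G\<rbrakk> \<Longrightarrow> b (c j v) = c j (b v)"
  shows "b \<in> cent i"
  unfolding cent_def hom_def using assms by blast

lemma finite_cent [simp]: "finite (cent i)"
proof (rule finite_subset)
  show "cent i \<subseteq> carrier G \<rightarrow>\<^sub>E carrier G"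
    unfolding PiE_def cent_def hom_def by blast
qed (simp add: finite_PiE fin)

context fixes i assumes i: "i \<in> J"
begin

lemma c_mult: "\<lbrakk>j \<in> J; v \<in> carrier G; w \<in> carrier G\<rbrakk> \<Longrightarrow> c j (v \<otimes> w) = c j v \<otimes> c j w"
  using S_mult c_S by blast

lemma c_closed [simp]: "\<lbrakk>j \<in> J; v \<in> carrier G\<rbrakk> \<Longrightarrow> c j v \<in> carrier G"
  using S_closed c_S by blast

lemma S_one: "\<lbrakk>j \<in> J; s \<in> S j\<rbrakk> \<Longrightarrow> s \<one> = \<one>"
  by (rule group_hom.hom_one[OF S_group_hom])

lemma S_m_inv: "\<lbrakk>j \<in> J; s \<in> S j; v \<in> carrier G\<rbrakk> \<Longrightarrow> s (inv v) = inv (s v)"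
  by (rule group_hom.hom_inv[OF S_group_hom])

lemma zero_cent [simp]: "(\<lambda>v\<in>carrier G. \<one>) \<in> cent i"
  by (intro centI) (auto simp: S_closed[OF i] S_one[OF i] S_one[OF _ c_S])

lemma id_cent [simp]: "(\<lambda>v\<in>carrier G. v) \<in> cent i"
  by (intro centI) (auto simp: S_closed[OF i])

lemma plus_cent [simp]: "\<lbrakk>a \<in> cent i; b \<in> cent i\<rbrakk> \<Longrightarrow> plus a b \<in> cent i"
  by (intro centI)
    (auto simp: plus_def S_closed[OF i] cent_mult m_ac cent_commute_S cent_commute_c[OF i]
      S_mult[OF i] c_mult)

lemma neg_cent [simp]: "a \<in> cent i \<Longrightarrow> neg a \<in> cent i"
  by (intro centI)
    (auto simp: neg_def S_closed[OF i] cent_mult inv_mult cent_commute_S cent_commute_c[OF i]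
      S_m_inv[OF i] S_m_inv[OF _ c_S])

lemma comp_cent [simp]: "\<lbrakk>a \<in> cent i; b \<in> cent i\<rbrakk> \<Longrightarrow> compose (carrier G) a b \<in> cent i"
  by (intro centI)
    (auto simp: compose_def S_closed[OF i] cent_mult cent_commute_S cent_commute_c[OF i])

text \<open>The groups other than \<open>S i\<close> embed into the ring, since they commute with
  \<open>S i\<close> and with all \<open>c k\<close>. Hence a submodule over \<open>cent i\<close>
  is invariant under every \<open>S j\<close> except possibly \<open>S i\<close>.\<close>

lemma S_cent:
  assumes "j \<in> J" "j \<noteq> i" "s \<in> S j"
  shows "restrict s (carrier G) \<in> cent i"
  using assms S_comm[of j i s, OF _ i]
  by (intro centI) (auto simp: S_closed S_closed[OF i] S_mult c_all)

section \<open>Submodules over a centralizer ring\<close>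

lemma submod_subgroup: "submod i U \<Longrightarrow> subgroup U G" by (simp add: submod_def)

lemma submod_carrier: "\<lbrakk>submod i U; u \<in> U\<rbrakk> \<Longrightarrow> u \<in> carrier G"
  using submod_subgroup subgroup.mem_carrier by fast

lemma submod_cent: "\<lbrakk>submod i U; b \<in> cent i; u \<in> U\<rbrakk> \<Longrightarrow> b u \<in> U"
  by (simp add: submod_def)

lemma submod_S:
  assumes "submod i U" "j \<in> J" "j \<noteq> i" "s \<in> S j" "u \<in> U" shows "s u \<in> U"
  using submod_cent[OF assms(1) S_cent[OF assms(2-4)] assms(5)] submod_carrier[OF assms(1,5)] by simp

lemma submod_whole: "submod i (carrier G)"
  by (simp add: submod_def subgroup_self)

lemma submodI:
  assumes "U \<subseteq> carrier G" "\<one> \<in> U" "\<And>u v. \<lbrakk>u \<in> U; v \<in> U\<rbrakk> \<Longrightarrow> u \<otimes> v \<in> U"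
    "\<And>u. u \<in> U \<Longrightarrow> inv u \<in> U" "\<And>b u. \<lbrakk>b \<in> cent i; u \<in> U\<rbrakk> \<Longrightarrow> b u \<in> U"
  shows "submod i U"
  using assms unfolding submod_def by (auto intro!: subgroupI)

text \<open>The hypotheses make \<open>I\<close> a left ideal. It is applied to the whole ring,
  giving cyclic submodules, and to the annihilator of an element in
  \<open>cyclic_or_free\<close>.\<close>

lemma submod_image_ideal:
  assumes "t \<in> carrier G" "I \<subseteq> cent i" "(\<lambda>v\<in>carrier G. \<one>) \<in> I"
    "\<And>a b. \<lbrakk>a \<in> I; b \<in> I\<rbrakk> \<Longrightarrow> plus a b \<in> I" "\<And>a. a \<in> I \<Longrightarrow> neg a \<in> I"
    "\<And>a b. \<lbrakk>a \<in> cent i; b \<in> I\<rbrakk> \<Longrightarrow> compose (carrier G) a b \<in> I"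
  shows "submod i ((\<lambda>b. b t) ` I)"
proof (rule submodI)
  show "(\<lambda>b. b t) ` I \<subseteq> carrier G" using assms by auto
  show "\<one> \<in> (\<lambda>b. b t) ` I" using assms(1) by (intro image_eqI[OF _ assms(3)]) simp
  fix u assume "u \<in> (\<lambda>b. b t) ` I"
  then obtain a where a: "a \<in> I" "u = a t" by auto
  show "inv u \<in> (\<lambda>b. b t) ` I" using a assms(1)
    by (intro image_eqI[OF _ assms(5)[OF a(1)]]) simp
  show "b u \<in> (\<lambda>b. b t) ` I" if "b \<in> cent i" for b
    using a assms(1) by (intro image_eqI[OF _ assms(6)[OF that a(1)]]) (simp add: compose_def)
  fix v assume "v \<in> (\<lambda>b. b t) ` I"
  then obtain b where b: "b \<in> I" "v = b t" by auto
  show "u \<otimes> v \<in> (\<lambda>b. b t) ` I" using a b assms(1)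
    by (intro image_eqI[OF _ assms(4)[OF a(1) b(1)]]) simp
qed

lemma submod_cyc: "z \<in> carrier G \<Longrightarrow> submod i (cyc i z)"
  unfolding cyc_def by (rule submod_image_ideal) auto

lemma cyc_self: "z \<in> carrier G \<Longrightarrow> z \<in> cyc i z"
  unfolding cyc_def by (rule image_eqI[OF _ id_cent]) simp

lemma cyc_least: "\<lbrakk>submod i U; z \<in> U\<rbrakk> \<Longrightarrow> cyc i z \<subseteq> U"
  by (auto simp: cyc_def submod_cent)

section \<open>Minimal submodules and semisimplicity\<close>

lemma ex_minimal_submod:
  assumes "submod i U" "U \<noteq> {\<one>}"
  shows "\<exists>T\<subseteq>U. minimal_submod i T"
proof -
  let ?A = "{T. submod i T \<and> T \<subseteq> U \<and> T \<noteq> {\<one>}}"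
  have "?A \<subseteq> Pow (carrier G)" by (auto dest: submod_carrier)
  then have "finite ?A" using fin by (meson finite_Pow_iff finite_subset)
  moreover have "U \<in> ?A" using assms by simp
  ultimately obtain T where T: "T \<in> ?A" "\<And>T'. T' \<in> ?A \<Longrightarrow> T' \<subseteq> T \<Longrightarrow> T' = T"
    by (metis (no_types, lifting) empty_iff finite_has_minimal)
  then have "minimal_submod i T" unfolding minimal_submod_def by blast
  then show ?thesis using T(1) by blast
qed

text \<open>The elements killed by the whole annihilator of \<open>T\<close> form a subgroup
  \<open>?X\<close> containing \<open>T\<close>. It is invariant under \<open>S i\<close>, which
  commutes with the ring, and under the other groups, so by irreducibility it is everything.\<close>

lemma faithful_on_minimal:
  assumes T: "minimal_submod i T" and b: "b \<in> cent i" "\<And>t. t \<in> T \<Longrightarrow> b t = \<one>"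
    and v: "v \<in> carrier G"
  shows "b v = \<one>"
proof -
  have sT: "submod i T" "T \<noteq> {\<one>}" using T by (auto simp: minimal_submod_def)
  let ?X = "{v \<in> carrier G. \<forall>b\<in>cent i. (\<forall>t\<in>T. b t = \<one>) \<longrightarrow> b v = \<one>}"
  have "subgroup ?X G"
    by (rule subgroupI) (auto intro!: exI[of _ \<one>] simp: cent_mult cent_inv)
  moreover have "s u \<in> ?X" if j: "j \<in> J" "s \<in> S j" and u: "u \<in> ?X" for j s u
  proof (cases "j = i")
    case True
    then have s: "s \<in> S i" using j by simp
    show ?thesis using u by (auto simp: cent_commute_S[OF _ s] S_closed[OF i s] S_one[OF i s])
  next
    case False
    have "b (s u) = \<one>" if b: "b \<in> cent i" "\<forall>t\<in>T. b t = \<one>" for b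
    proof -
      \<comment> \<open>As \<open>s\<close> lies in the ring and preserves \<open>T\<close>, the
        product of \<open>b\<close> and \<open>s\<close> annihilates \<open>T\<close> again.\<close>
      let ?b = "compose (carrier G) b (restrict s (carrier G))"
      have "?b \<in> cent i" using b S_cent[OF j(1) False j(2)] by simp
      moreover have "\<forall>t\<in>T. ?b t = \<one>"
        using b submod_S[OF sT(1) j(1) False j(2)] submod_carrier[OF sT(1)]
        by (simp add: compose_def)
      ultimately have "?b u = \<one>" using u by blast
      then show ?thesis using u by (simp add: compose_def)
    qed
    then show ?thesis using u j by (auto simp: S_closed)
  qed
  ultimately have "?X = {\<one>} \<or> ?X = carrier G" by (rule irreducible)
  moreover have "T \<subseteq> ?X" using submod_carrier[OF sT(1)] by auto
  moreover have "\<one> \<in> T" using submod_subgroup[OF sT(1)] subgroup.one_closed by blast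
  ultimately have "?X = carrier G" using sT(2) by auto
  then show ?thesis using b v by blast
qed

text \<open>Elements of \<open>S i\<close> commute with the ring and are injective, so
  \<open>s\<close> is a module isomorphism from \<open>T\<close> onto its image.\<close>

lemma minimal_submod_S_image:
  assumes T: "minimal_submod i T" and s: "s \<in> S i"
  shows "minimal_submod i (s ` T)"
proof -
  have sT: "submod i T" "T \<noteq> {\<one>}" using T by (auto simp: minimal_submod_def)
  interpret s: group_hom G G s using S_group_hom[OF i s] .
  note cT = submod_carrier[OF sT(1)]
  have "b (s t) \<in> s ` T" if "b \<in> cent i" "t \<in> T" for b t
    using cent_commute_S[OF that(1) s cT[OF that(2)]] submod_cent[OF sT(1) that] by simp
  then have "submod i (s ` T)"
    unfolding submod_def
    using s.subgroup_img_is_subgroup[OF submod_subgroup[OF sT(1)]] by blast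
  moreover have "s ` T \<noteq> {\<one>}"
  proof
    assume "s ` T = {\<one>}"
    then have "\<forall>t\<in>T. t = \<one>" using S_inj[OF i s cT] by blast
    then show False using sT submod_subgroup subgroup.one_closed by blast
  qed
  moreover have "U = {\<one>} \<or> U = s ` T" if U: "submod i U" "U \<subseteq> s ` T" for U
  proof -
    let ?U = "{t \<in> T. s t \<in> U}"
    have "submod i ?U"
      by (rule submodI)
        (use cT submod_subgroup[OF U(1)] submod_subgroup[OF sT(1)] in
          \<open>auto simp: subgroup.one_closed subgroup.m_closed subgroup.m_inv_closed
             submod_cent[OF sT(1)] submod_cent[OF U(1)] cent_commute_S[OF _ s, symmetric]\<close>)
    then have "?U = {\<one>} \<or> ?U = T" using T unfolding minimal_submod_def by blast
    moreover have "U = s ` ?U" using U(2) by auto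
    ultimately show ?thesis by auto
  qed
  ultimately show ?thesis unfolding minimal_submod_def by blast
qed

text \<open>Clifford's argument: the least submodule \<open>?X\<close> containing all minimal ones
  is invariant under \<open>S i\<close>, which maps minimal submodules to minimal submodules, and
  under the other groups because it is a submodule. Irreducibility makes it the whole group.\<close>

lemma minimal_submods_span:
  assumes M: "submod i M" "\<And>T. minimal_submod i T \<Longrightarrow> T \<subseteq> M"
  shows "M = carrier G"
proof -
  let ?A = "{M. submod i M \<and> (\<forall>T. minimal_submod i T \<longrightarrow> T \<subseteq> M)}"
  let ?X = "\<Inter>?A"
  have M: "M \<in> ?A" using M by blast
  have W: "carrier G \<in> ?A" using submod_whole submod_carrier unfolding minimal_submod_def by blast
  have "subgroup ?X G"
    by (rule subgroups_Inter) (use W submod_subgroup in auto)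
  moreover have "s u \<in> ?X" if j: "j \<in> J" "s \<in> S j" and u: "u \<in> ?X" for j s u
  proof (cases "j = i")
    case True
    have s: "s \<in> S i" using j True by simp
    interpret s: group_hom G G s using S_group_hom[OF i s] .
    have "s u \<in> M" if M: "M \<in> ?A" for M
    proof -
      have mM: "submod i M" using M by simp
      \<comment> \<open>The preimage of \<open>M\<close> under \<open>s\<close> again contains every
        minimal submodule, so it takes part in the intersection \<open>?X\<close>.\<close>
      let ?M = "{v \<in> carrier G. s v \<in> M}"
      have "submod i ?M"
        by (rule submodI)
          (use submod_subgroup[OF mM] in
            \<open>auto simp: subgroup.one_closed subgroup.m_closed subgroup.m_inv_closed
               submod_cent[OF mM] cent_commute_S[OF _ s, symmetric]\<close>)
      moreover have "T \<subseteq> ?M" if T: "minimal_submod i T" for T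
      proof -
        have "s ` T \<subseteq> M" using M minimal_submod_S_image[OF T s] by blast
        moreover have "T \<subseteq> carrier G" using T submod_carrier unfolding minimal_submod_def by blast
        ultimately show ?thesis by auto
      qed
      ultimately have "u \<in> ?M" using u by blast
      then show ?thesis by simp
    qed
    then show ?thesis by blast
  next
    case False
    then show ?thesis using submod_S j u by blast
  qed
  ultimately have "?X = {\<one>} \<or> ?X = carrier G" by (rule irreducible)
  moreover obtain T where T: "minimal_submod i T"
    using ex_minimal_submod[OF submod_whole nontriv] by blast
  moreover have "T \<subseteq> ?X" using T by blast
  moreover have "\<one> \<in> T" "T \<noteq> {\<one>}"
    using T submod_subgroup subgroup.one_closed unfolding minimal_submod_def by blast+
  ultimately have "?X = carrier G" by auto
  then show ?thesis using M submod_carrier[of M] by blast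
qed

lemma submod_mult:
  assumes "submod i U" "submod i V"
  shows "submod i {u \<otimes> v | u v. u \<in> U \<and> v \<in> V}"
proof (rule submodI)
  note [simp] = submod_carrier[OF assms(1)] submod_carrier[OF assms(2)]
  note U = submod_subgroup[OF assms(1)] and V = submod_subgroup[OF assms(2)]
  show "{u \<otimes> v | u v. u \<in> U \<and> v \<in> V} \<subseteq> carrier G" by auto
  show "\<one> \<in> {u \<otimes> v | u v. u \<in> U \<and> v \<in> V}"
    using subgroup.one_closed[OF U] subgroup.one_closed[OF V] by force
  fix x assume "x \<in> {u \<otimes> v | u v. u \<in> U \<and> v \<in> V}"
  then obtain u v where x: "x = u \<otimes> v" "u \<in> U" "v \<in> V" by auto
  show "inv x \<in> {u \<otimes> v | u v. u \<in> U \<and> v \<in> V}"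
    using x subgroup.m_inv_closed[OF U] subgroup.m_inv_closed[OF V] by (auto simp: inv_mult)
  show "b x \<in> {u \<otimes> v | u v. u \<in> U \<and> v \<in> V}" if "b \<in> cent i" for b
    using x that submod_cent[OF assms(1) that x(2)] submod_cent[OF assms(2) that x(3)]
    by (auto simp: cent_mult)
  fix y assume "y \<in> {u \<otimes> v | u v. u \<in> U \<and> v \<in> V}"
  then obtain u' v' where y: "y = u' \<otimes> v'" "u' \<in> U" "v' \<in> V" by auto
  have "x \<otimes> y = (u \<otimes> u') \<otimes> (v \<otimes> v')" using x y by (simp add: m_ac)
  then show "x \<otimes> y \<in> {u \<otimes> v | u v. u \<in> U \<and> v \<in> V}"
    using x y subgroup.m_closed[OF U] subgroup.m_closed[OF V] by blast
qed

text \<open>A submodule \<open>Y\<close> maximal subject to meeting \<open>Q\<close> trivially is a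
  complement: a minimal submodule outside the product of \<open>Q\<close> and \<open>Y\<close> could
  be added to \<open>Y\<close>, so that product contains all minimal submodules.\<close>

lemma ex_complement:
  assumes Q: "submod i Q"
  shows "\<exists>Y. submod i Y \<and> Q \<inter> Y = {\<one>} \<and> (\<forall>x\<in>carrier G. \<exists>u\<in>Q. \<exists>v\<in>Y. x = u \<otimes> v)"
proof -
  let ?A = "{Y. submod i Y \<and> Q \<inter> Y = {\<one>}}"
  have "?A \<subseteq> Pow (carrier G)" by (auto dest: submod_carrier)
  then have "finite ?A" using fin by (meson finite_Pow_iff finite_subset)
  moreover have "{\<one>} \<in> ?A"
    using subgroup.one_closed[OF submod_subgroup[OF Q]] by (auto intro!: submodI)
  ultimately obtain Y where Y: "Y \<in> ?A" "\<And>Y'. Y' \<in> ?A \<Longrightarrow> Y \<subseteq> Y' \<Longrightarrow> Y' = Y"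
    by (metis (no_types, lifting) empty_iff finite_has_maximal)
  have mY: "submod i Y" "Q \<inter> Y = {\<one>}" using Y(1) by auto
  let ?M = "{u \<otimes> v | u v. u \<in> Q \<and> v \<in> Y}"
  note QG = submod_subgroup[OF Q] and YG = submod_subgroup[OF mY(1)]
  have mM: "submod i ?M" using submod_mult[OF Q mY(1)] .
  have "T \<subseteq> ?M" if T: "minimal_submod i T" for T
  proof (rule ccontr)
    assume nT: "\<not> T \<subseteq> ?M"
    have mT: "submod i T" using T by (simp add: minimal_submod_def)
    note TG = submod_subgroup[OF mT]
    have "submod i (T \<inter> ?M)"
      using subgroups_Inter_pair[OF TG submod_subgroup[OF mM]] submod_cent[OF mT] submod_cent[OF mM]
      unfolding submod_def by blast
    then have TM: "T \<inter> ?M = {\<one>}" using T nT unfolding minimal_submod_def by blast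
    let ?Y = "{u \<otimes> v | u v. u \<in> Y \<and> v \<in> T}"
    note [simp] = submod_carrier[OF Q] submod_carrier[OF mY(1)] submod_carrier[OF mT]
    have "q = \<one>" if "q \<in> Q" "y \<in> Y" "t \<in> T" "q = y \<otimes> t" for q y t
    proof -
      have "t = q \<otimes> inv y" using that by (simp add: m_ac)
      then have "t \<in> ?M" using that subgroup.m_inv_closed[OF YG] by auto
      then have "t = \<one>" using TM that by blast
      then show ?thesis using that mY(2) by auto
    qed
    then have "Q \<inter> ?Y \<subseteq> {\<one>}" by auto
    moreover have "submod i ?Y" using submod_mult[OF mY(1) mT] .
    ultimately have "?Y \<in> ?A"
      using subgroup.one_closed[OF QG] subgroup.one_closed[OF submod_subgroup] by blast
    moreover have "Y \<subseteq> ?Y" using subgroup.one_closed[OF TG] by force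
    ultimately have "?Y = Y" using Y(2) by blast
    moreover have "T \<subseteq> ?Y" using subgroup.one_closed[OF YG] by force
    moreover have "Y \<subseteq> ?M" using subgroup.one_closed[OF QG] by force
    ultimately show False using nT by auto
  qed
  then have "?M = carrier G" by (rule minimal_submods_span[OF mM])
  then have "\<exists>u\<in>Q. \<exists>v\<in>Y. x = u \<otimes> v" if "x \<in> carrier G" for x using that by blast
  then show ?thesis using mY by blast
qed

text \<open>Projection along a complement; it commutes with the ring because both summands are
  submodules.\<close>

lemma ex_projection:
  assumes Q: "submod i Q"
  shows "\<exists>\<pi>. (\<forall>v\<in>carrier G. \<pi> v \<in> Q) \<and> (\<forall>q\<in>Q. \<pi> q = q) \<and>
    (\<forall>v\<in>carrier G. \<forall>w\<in>carrier G. \<pi> (v \<otimes> w) = \<pi> v \<otimes> \<pi> w) \<and>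
    (\<forall>b\<in>cent i. \<forall>v\<in>carrier G. \<pi> (b v) = b (\<pi> v))"
proof -
  obtain Y where Y: "submod i Y" "Q \<inter> Y = {\<one>}" "\<forall>x\<in>carrier G. \<exists>u\<in>Q. \<exists>v\<in>Y. x = u \<otimes> v"
    using ex_complement[OF Q] by blast
  note [simp] = submod_carrier[OF Q] submod_carrier[OF Y(1)]
  note QG = submod_subgroup[OF Q] and YG = submod_subgroup[OF Y(1)]
  define \<pi> where "\<pi> v = (THE u. u \<in> Q \<and> (\<exists>y\<in>Y. v = u \<otimes> y))" for v
  have \<pi>: "\<pi> (u \<otimes> y) = u" if "u \<in> Q" "y \<in> Y" for u y
    unfolding \<pi>_def
  proof (rule the_equality)
    fix u' assume "u' \<in> Q \<and> (\<exists>y'\<in>Y. u \<otimes> y = u' \<otimes> y')"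
    then obtain y' where u': "u' \<in> Q" "y' \<in> Y" "u \<otimes> y = u' \<otimes> y'" by blast
    have "inv u \<otimes> u' = inv u \<otimes> (u' \<otimes> y') \<otimes> inv y'"
      using that u'(1,2) by (simp add: m_assoc)
    also have "\<dots> = inv u \<otimes> (u \<otimes> y) \<otimes> inv y'" using u'(3) by simp
    also have "\<dots> = y \<otimes> inv y'" using that u'(1,2) by (simp add: m_assoc[symmetric])
    finally have "inv u \<otimes> u' = y \<otimes> inv y'" .
    moreover have "inv u \<otimes> u' \<in> Q" "y \<otimes> inv y' \<in> Y"
      using that u' QG YG by (auto simp: subgroup.m_closed subgroup.m_inv_closed)
    ultimately have "inv u \<otimes> u' = \<one>" using Y(2) by auto
    then show "u' = u" using that u' mult_inv_eq_one_iff[of u' u] by (simp add: m_comm)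
  qed (use that in blast)
  have decomp: "\<exists>u\<in>Q. \<exists>y\<in>Y. v = u \<otimes> y" if "v \<in> carrier G" for v
    using that Y(3) by blast
  have "\<pi> v \<in> Q" if "v \<in> carrier G" for v
    using decomp[OF that] \<pi> by auto
  moreover have "\<pi> q = q" if "q \<in> Q" for q
    using \<pi>[OF that subgroup.one_closed[OF YG]] that by simp
  moreover have "\<pi> (v \<otimes> w) = \<pi> v \<otimes> \<pi> w" if vw: "v \<in> carrier G" "w \<in> carrier G" for v w
  proof -
    obtain u y u' y' where v: "u \<in> Q" "y \<in> Y" "v = u \<otimes> y" and w: "u' \<in> Q" "y' \<in> Y" "w = u' \<otimes> y'"
      using decomp[OF vw(1)] decomp[OF vw(2)] by blast
    then have "v \<otimes> w = (u \<otimes> u') \<otimes> (y \<otimes> y')" by (simp add: m_ac)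
    then show ?thesis
      using v w \<pi> subgroup.m_closed[OF QG, of u u'] subgroup.m_closed[OF YG, of y y'] by simp
  qed
  moreover have "\<pi> (b v) = b (\<pi> v)" if b: "b \<in> cent i" and v': "v \<in> carrier G" for b v
  proof -
    obtain u y where v: "u \<in> Q" "y \<in> Y" "v = u \<otimes> y" using decomp[OF v'] by blast
    then have "b v = b u \<otimes> b y" using b by (simp add: cent_mult)
    then show ?thesis
      using v \<pi> submod_cent[OF Q b, of u] submod_cent[OF Y(1) b, of y] by simp
  qed
  ultimately show ?thesis by blast
qed

section \<open>Evaluation maps and the number of nonunits\<close>

lemma plus_neg_cancel:
  assumes "a \<in> cent i" "b \<in> cent i"
  shows "plus (plus b a) (neg a) = b" "plus (plus b (neg a)) a = b"
  using assms by (auto intro!: cent_eqI simp del: plus_apply neg_apply) (simp_all add: cent_closed[OF assms(1)] cent_closed[OF assms(2)] m_assoc)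

text \<open>Evaluation at \<open>z\<close> is additive on the ring, so each nonempty fibre is a
  translate of the annihilator of \<open>z\<close>.\<close>

lemma card_evaluation_vimage:
  assumes z: "z \<in> carrier G" and A: "A \<subseteq> cyc i z"
  shows "card {b \<in> cent i. b z \<in> A} = card A * card {b \<in> cent i. b z = \<one>}"
proof -
  have fiber: "card {b \<in> cent i. b z = x} = card {b \<in> cent i. b z = \<one>}" if x: "x \<in> cyc i z" for x
  proof -
    obtain a where a: "a \<in> cent i" "a z = x" using x by (auto simp: cyc_def)
    have "bij_betw (\<lambda>b. plus b a) {b \<in> cent i. b z = \<one>} {b \<in> cent i. b z = x}"
      by (rule bij_betw_byWitness[where f' = "\<lambda>b. plus b (neg a)"])
        (use a z in \<open>auto simp: plus_neg_cancel\<close>)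
    then show ?thesis by (rule bij_betw_same_card[symmetric])
  qed
  have "{b \<in> cent i. b z \<in> A} = (\<Union>x\<in>A. {b \<in> cent i. b z = x})" by auto
  also have "card \<dots> = (\<Sum>x\<in>A. card {b \<in> cent i. b z = x})"
    using finite_subset[OF A] by (intro card_UN_disjoint) (auto simp: cyc_def)
  also have "\<dots> = card A * card {b \<in> cent i. b z = \<one>}"
    using A fiber by (simp add: subset_eq)
  finally show ?thesis .
qed

lemma card_cent_evaluation:
  assumes "z \<in> carrier G"
  shows "card (cent i) = card (cyc i z) * card {b \<in> cent i. b z = \<one>}"
proof -
  have "{b \<in> cent i. b z \<in> cyc i z} = cent i" by (auto simp: cyc_def)
  then show ?thesis using card_evaluation_vimage[OF assms order_refl] by simp
qed

text \<open>For minimal \<open>T\<close> these are the nonunits of the ring, detected on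
  \<open>T\<close> alone.\<close>

definition singulars :: "'a set \<Rightarrow> ('a \<Rightarrow> 'a) set" where
  "singulars T = {b \<in> cent i. \<exists>t\<in>T. t \<noteq> \<one> \<and> b t = \<one>}"

lemma finite_singulars [simp]: "finite (singulars T)"
  by (simp add: singulars_def)

text \<open>Count the pairs \<open>(b, t)\<close> with \<open>b t = \<one>\<close>: a kernel that contains \<open>t\<close> also contains the elements
  \<open>c l t\<close> for \<open>l \<noteq> i\<close>, and these are pairwise distinct.\<close>

lemma card_singulars:
  assumes T: "minimal_submod i T"
  shows "card (singulars T) * card J < card (cent i)"
proof -
  have sT: "submod i T" "T \<noteq> {\<one>}" using T by (auto simp: minimal_submod_def)
  note cT = submod_carrier[OF sT(1)]
  have finT: "finite T" using cT fin by (meson finite_subset subsetI)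
  have oneT: "\<one> \<in> T" using submod_subgroup[OF sT(1)] subgroup.one_closed by blast
  let ?k = "\<lambda>t. card {b \<in> cent i. b t = \<one>}"
  \<comment> \<open>By minimality every nontrivial \<open>t\<close> generates \<open>T\<close>, so
    evaluation at \<open>t\<close> maps the ring onto \<open>T\<close>.\<close>
  have k: "?k t * card T = card (cent i)" if t: "t \<in> T - {\<one>}" for t
  proof -
    have "cyc i t = T"
      using T t cyc_least[OF sT(1), of t] submod_cyc[OF cT] cyc_self[OF cT]
      unfolding minimal_submod_def by blast
    then show ?thesis using card_cent_evaluation[of t] t cT by simp
  qed
  have ker: "card J \<le> card {t \<in> T - {\<one>}. b t = \<one>}" if b: "b \<in> singulars T" for b
  proof -
    obtain t where t: "b \<in> cent i" "t \<in> T" "t \<noteq> \<one>" "b t = \<one>" using b by (auto simp: singulars_def)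
    \<comment> \<open>The slot of \<open>i\<close> holds \<open>t\<close> itself, so that exactly
      \<open>card J\<close> distinct kernel elements are listed.\<close>
    define g where "g l = (if l = i then t else c l t)" for l
    have "inj_on g J"
    proof (rule inj_onI)
      fix l k assume lk: "l \<in> J" "k \<in> J" "g l = g k"
      show "l = k"
        using lk t(2,3) cT c_fixes_only_one[of _ t] c_agree_only_one[of l k t]
        unfolding g_def by (metis (full_types))
    qed
    moreover have "g ` J \<subseteq> {t \<in> T - {\<one>}. b t = \<one>}"
    proof
      fix x assume "x \<in> g ` J"
      then obtain l where l: "l \<in> J" "x = g l" by blast
      show "x \<in> {t \<in> T - {\<one>}. b t = \<one>}"
      proof (cases "l = i")
        case False
        have "c l t \<in> T" using submod_S[OF sT(1) l(1) False c_S[OF l(1)] t(2)] .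
        moreover have "c l t \<noteq> \<one>" using S_inj[OF l(1) c_S[OF l(1)] cT[OF t(2)]] t(3) by blast
        moreover have "b (c l t) = \<one>"
          using cent_commute_c[OF i t(1) l(1) cT[OF t(2)]] t(4) S_one[OF l(1) c_S[OF l(1)]] by simp
        ultimately show ?thesis using l False by (simp add: g_def)
      qed (use l t in \<open>simp add: g_def\<close>)
    qed
    ultimately show ?thesis using finT by (intro card_inj_on_le[of g]) auto
  qed
  have "card (singulars T) * card J = (\<Sum>b\<in>singulars T. card J)" by simp
  also have "\<dots> \<le> (\<Sum>b\<in>singulars T. card {t \<in> T - {\<one>}. b t = \<one>})"
    by (rule sum_mono) (rule ker)
  also have "\<dots> \<le> (\<Sum>b\<in>cent i. card {t \<in> T - {\<one>}. b t = \<one>})"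
    by (rule sum_mono2) (auto simp: singulars_def)
  also have "\<dots> = (\<Sum>t\<in>T - {\<one>}. ?k t)"
    by (rule sum_multicount_gen) (use finT in auto)
  finally have "card (singulars T) * card J * card T \<le> (\<Sum>t\<in>T - {\<one>}. ?k t) * card T"
    by (rule mult_le_mono1)
  also have "\<dots> = (\<Sum>t\<in>T - {\<one>}. card (cent i))"
    unfolding sum_distrib_right using k by (intro sum.cong) auto
  \<comment> \<open>Strictness comes from leaving out the neutral element of \<open>T\<close>; the
    common factor \<open>card T\<close> is then cancelled.\<close>
  also have "\<dots> < card T * card (cent i)"
  proof -
    have "cent i \<noteq> {}" using id_cent by blast
    then have "0 < card T" "0 < card (cent i)" using oneT finT by (auto simp: card_gt_0_iff)
    moreover have "card (T - {\<one>}) < card T" using oneT finT by (rule card_Diff1_less[rotated])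
    ultimately show ?thesis by simp
  qed
  finally show ?thesis by (simp add: mult.commute)
qed

text \<open>Elements that are injective on \<open>T\<close> are units, as right multiplication by them is
  injective on the finite ring.\<close>

lemma nonsingular_left_inverse:
  assumes T: "minimal_submod i T" and b: "b \<in> cent i" "b \<notin> singulars T"
  shows "\<exists>a\<in>cent i. \<forall>v\<in>carrier G. a (b v) = v"
proof -
  have sT: "submod i T" using T by (auto simp: minimal_submod_def)
  note cT = submod_carrier[OF sT] and TG = submod_subgroup[OF sT]
  have finT: "finite T" using cT fin by (meson finite_subset subsetI)
  have "inj_on b T"
  proof (rule inj_onI)
    fix t u assume tu: "t \<in> T" "u \<in> T" "b t = b u"
    then have "b (t \<otimes> inv u) = \<one>" using b(1) cT by (simp add: cent_mult cent_inv)
    moreover have "t \<otimes> inv u \<in> T" using tu TG by (simp add: subgroup.m_closed subgroup.m_inv_closed)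
    ultimately have "t \<otimes> inv u = \<one>" using b unfolding singulars_def by blast
    then show "t = u" using mult_inv_eq_one_iff tu cT by simp
  qed
  then have bT: "b ` T = T" using submod_cent[OF sT b(1)] finT by (intro endo_inj_surj) auto
  let ?F = "\<lambda>a. compose (carrier G) a b"
  have "inj_on ?F (cent i)"
  proof (rule inj_onI)
    fix a a' assume a: "a \<in> cent i" "a' \<in> cent i" "?F a = ?F a'"
    \<comment> \<open>Since \<open>b\<close> permutes \<open>T\<close>, equal products with
      \<open>b\<close> agree on \<open>T\<close>; the difference of \<open>a\<close> and
      \<open>a'\<close> then vanishes everywhere by faithfulness.\<close>
    have aa': "a t = a' t" if "t \<in> T" for t
    proof -
      obtain u where u: "u \<in> T" "t = b u" using \<open>t \<in> T\<close> bT by blast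
      then have "?F a u = ?F a' u" using a(3) by simp
      then show ?thesis using u cT by (simp add: compose_def)
    qed
    have "plus a (neg a') v = \<one>" if "v \<in> carrier G" for v
    proof (rule faithful_on_minimal[OF T _ _ that])
      show "plus a (neg a') t = \<one>" if "t \<in> T" for t
        using aa'[OF that] a(2) cT[OF that] by simp
    qed (use a in simp)
    then have "a v = a' v" if "v \<in> carrier G" for v
      using that a mult_inv_eq_one_iff[of "a v" "a' v"] by simp
    then show "a = a'" by (rule cent_eqI[OF a(1,2)])
  qed
  then have "?F ` cent i = cent i" using b by (intro endo_inj_surj) auto
  then obtain a where a: "a \<in> cent i" "(\<lambda>v\<in>carrier G. v) = ?F a" using id_cent by blast
  then have "(\<lambda>v\<in>carrier G. v) v = ?F a v" for v by simp
  then have "a (b v) = v" if "v \<in> carrier G" for v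
    using that by (simp add: compose_def) metis
  then show ?thesis using a by blast
qed

text \<open>Take \<open>w\<close> with \<open>B w\<close> maximal among those containing \<open>z\<close>. If \<open>a w = \<one>\<close> and \<open>a t = t\<close> for some \<open>t\<close> in
  a complement of \<open>B w\<close>, then \<open>w \<otimes> t\<close> generates a larger submodule.\<close>

lemma cyclic_or_free:
  assumes z: "z \<in> carrier G"
  shows "\<exists>w\<in>carrier G. z \<in> cyc i w \<and>
    (cyc i w = carrier G \<or> (\<forall>b\<in>cent i. b w = \<one> \<longrightarrow> (\<forall>v\<in>carrier G. b v = \<one>)))"
proof -
  let ?A = "{w \<in> carrier G. z \<in> cyc i w}"
  let ?C = "(\<lambda>w. card (cyc i w)) ` ?A"
  have fC: "finite ?C" using fin by simp
  have "z \<in> ?A" using z cyc_self by simp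
  then have "Max ?C \<in> ?C" using fC by (intro Max_in) auto
  then obtain w where w: "w \<in> ?A" "Max ?C = card (cyc i w)" by blast
  have w_max: "card (cyc i w') \<le> card (cyc i w)" if "w' \<in> ?A" for w'
    using Max_ge[OF fC, of "card (cyc i w')"] that w(2) by auto
  have wG: "w \<in> carrier G" using w by simp
  let ?Q = "cyc i w"
  have Q: "submod i ?Q" using submod_cyc wG by simp
  have "cyc i w = carrier G" if b: "b \<in> cent i" "b w = \<one>" and v: "v \<in> carrier G" "b v \<noteq> \<one>" for b v
  proof (rule ccontr)
    assume nQ: "?Q \<noteq> carrier G"
    obtain Y where Y: "submod i Y" "?Q \<inter> Y = {\<one>}" "\<forall>x\<in>carrier G. \<exists>u\<in>?Q. \<exists>v\<in>Y. x = u \<otimes> v"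
      using ex_complement[OF Q] by blast
    have "Y \<noteq> {\<one>}"
    proof
      assume "Y = {\<one>}"
      then have "x \<in> ?Q" if "x \<in> carrier G" for x
        using bspec[OF Y(3) that] submod_carrier[OF Q] by force
      then show False using nQ submod_carrier[OF Q] by blast
    qed
    then obtain T where T: "T \<subseteq> Y" "minimal_submod i T" using ex_minimal_submod[OF Y(1)] by blast
    have sT: "submod i T" using T by (simp add: minimal_submod_def)
    note cT = submod_carrier[OF sT]
    obtain t where t: "t \<in> T" "b t \<noteq> \<one>" using faithful_on_minimal[OF T(2) b(1)] v by blast
    \<comment> \<open>The annihilator of \<open>w\<close> contains \<open>b\<close> and
      \<open>b\<close> does not kill \<open>t\<close>, so the values of \<open>?I\<close> at
      \<open>t\<close> fill the minimal submodule \<open>T\<close>. In particular some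
      \<open>a\<close> in \<open>?I\<close> fixes \<open>t\<close>.\<close>
    let ?I = "{a \<in> cent i. a w = \<one>}"
    have "submod i ((\<lambda>a. a t) ` ?I)"
      using t cT wG by (intro submod_image_ideal) (auto simp: compose_eq)
    moreover have "(\<lambda>a. a t) ` ?I \<subseteq> T" using t submod_cent[OF sT] by blast
    moreover have "(\<lambda>a. a t) ` ?I \<noteq> {\<one>}" using b t by blast
    ultimately have "(\<lambda>a. a t) ` ?I = T" using T(2) unfolding minimal_submod_def by blast
    then have "t \<in> (\<lambda>a. a t) ` ?I" using t(1) by (simp only:)
    then obtain a where a: "a \<in> cent i" "a w = \<one>" "t = a t" by (elim imageE CollectE conjE)
    have tG: "t \<in> carrier G" using t cT by blast
    let ?R = "cyc i (w \<otimes> t)"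
    have R: "submod i ?R" using submod_cyc wG tG by simp
    \<comment> \<open>Thus \<open>a\<close> extracts \<open>t\<close> from
      \<open>w \<otimes> t\<close>, and dividing by \<open>t\<close> recovers \<open>w\<close>: both
      lie in \<open>?R\<close>.\<close>
    have "a (w \<otimes> t) = t" using a(1,2) a(3)[symmetric] wG tG by (simp add: cent_mult)
    then have tR: "t \<in> ?R" unfolding cyc_def by (intro image_eqI[OF _ a(1)]) (rule sym)
    have "(w \<otimes> t) \<otimes> inv t \<in> ?R"
      using submod_subgroup[OF R] cyc_self[of "w \<otimes> t"] tR wG tG
      by (simp add: subgroup.m_closed subgroup.m_inv_closed)
    then have "w \<in> ?R" using wG tG by (simp add: m_assoc)
    then have "?Q \<subseteq> ?R" by (rule cyc_least[OF R])
    moreover have "t \<noteq> \<one>" using t(2) cent_one[OF b(1)] by blast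
    then have "t \<notin> ?Q" using Y(2) T(1) t(1) by blast
    ultimately have "?Q \<subset> ?R" using tR by blast
    moreover have "finite ?R" by (simp add: cyc_def)
    ultimately have "card ?Q < card ?R" by (rule psubset_card_mono[rotated])
    moreover have "w \<otimes> t \<in> ?A" using \<open>?Q \<subseteq> ?R\<close> w(1) wG tG by auto
    ultimately show False using w_max by fastforce
  qed
  then show ?thesis using w(1) by blast
qed

section \<open>Choosing a translate with small stabilizers\<close>

text \<open>A unit \<open>b\<close> does not change stabilizers in \<open>S i\<close>: whatever
  fixes \<open>b w\<close> fixes \<open>w\<close>, hence all of \<open>cyc i w\<close>.\<close>

lemma left_inverse_fixes:
  assumes s: "s \<in> S i" and a: "a \<in> cent i" and b: "b \<in> cent i" "\<forall>v\<in>carrier G. a (b v) = v"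
    and w: "w \<in> carrier G" "s (b w) = b w" and z: "z \<in> cyc i w"
  shows "s z = z"
proof -
  have "s w = s (a (b w))" using b w by simp
  also have "\<dots> = a (s (b w))" using cent_commute_S[OF a s cent_closed[OF b(1) w(1)]] by (rule sym)
  also have "\<dots> = a (b w)" using w(2) by (rule arg_cong)
  also have "\<dots> = w" using b(2) w(1) by blast
  finally have "s w = w" .
  moreover obtain d where "d \<in> cent i" "z = d w" using z by (auto simp: cyc_def)
  ultimately show ?thesis using cent_commute_S[OF _ s w(1), of d] by simp
qed

text \<open>Writing an element as \<open>b w\<close>, it can be bad only if \<open>b\<close> is a
  nonunit. All evaluation fibres have the same size \<open>?k\<close>, so the bound on nonunits
  becomes a bound on elements; translating by \<open>y\<close> does not change the count.\<close>

lemma card_stabilized_cyclic: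
  assumes w: "w \<in> carrier G" "cyc i w = carrier G" and z: "z \<in> carrier G" and y: "y \<in> carrier G"
  shows "card {f \<in> carrier G. \<exists>s\<in>S i. s (f \<otimes> y) = f \<otimes> y \<and> s z \<noteq> z} * card J < card (carrier G)"
proof -
  obtain T where T: "minimal_submod i T" using ex_minimal_submod[OF submod_whole nontriv] by blast
  let ?A = "{u \<in> carrier G. \<exists>s\<in>S i. s u = u \<and> s z \<noteq> z}"
  let ?k = "card {b \<in> cent i. b w = \<one>}"
  have "{b \<in> cent i. b w \<in> ?A} \<subseteq> singulars T"
  proof (rule ccontr)
    assume "\<not> ?thesis"
    then obtain b s where b: "b \<in> cent i" "b \<notin> singulars T" "s \<in> S i" "s (b w) = b w" "s z \<noteq> z"
      by blast
    obtain a where "a \<in> cent i" "\<forall>v\<in>carrier G. a (b v) = v"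
      using nonsingular_left_inverse[OF T b(1,2)] by blast
    then have "s z = z" using left_inverse_fixes[OF b(3) _ b(1) _ w(1) b(4)] w z by blast
    then show False using b by blast
  qed
  then have "card {b \<in> cent i. b w \<in> ?A} \<le> card (singulars T)"
    by (rule card_mono[OF finite_singulars])
  moreover have "?A \<subseteq> cyc i w" unfolding w(2) by (rule Collect_restrict)
  ultimately have "card ?A * ?k \<le> card (singulars T)"
    using card_evaluation_vimage[OF w(1), of ?A] by (simp only:)
  then have "card ?A * ?k * card J \<le> card (singulars T) * card J" by (rule mult_le_mono1)
  also have "\<dots> < card (carrier G) * ?k"
    using card_singulars[OF T] card_cent_evaluation[OF w(1)] w(2) by simp
  finally have "card ?A * card J < card (carrier G)"
    by (simp add: mult.commute[of _ ?k] mult.assoc mult.left_commute)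
  moreover have "card {f \<in> carrier G. \<exists>s\<in>S i. s (f \<otimes> y) = f \<otimes> y \<and> s z \<noteq> z} \<le> card ?A"
    by (rule card_inj_on_le[of "\<lambda>f. f \<otimes> y"]) (use fin y in \<open>auto intro: inj_onI\<close>)
  ultimately show ?thesis by (meson le_less_trans mult_le_mono1)
qed

end

text \<open>Union bound: \<open>card J\<close> sets, each filling less than that fraction of
  \<open>A\<close>, cannot cover \<open>A\<close>.\<close>

lemma ex_avoiding:
  fixes B :: "'i \<Rightarrow> 'c set"
  assumes "J \<noteq> {}" "finite A" "\<And>j. j \<in> J \<Longrightarrow> B j \<subseteq> A \<and> card (B j) * card J < card A"
  shows "\<exists>a\<in>A. \<forall>j\<in>J. a \<notin> B j"
proof (rule ccontr)
  assume "\<not> ?thesis"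
  then have "A = (\<Union>j\<in>J. B j)" using assms(3) by blast
  then have "card A \<le> (\<Sum>j\<in>J. card (B j))" using card_UN_le[OF fin_J] by metis
  then have "card A * card J \<le> (\<Sum>j\<in>J. card (B j) * card J)"
    unfolding sum_distrib_right[symmetric] by (rule mult_le_mono1)
  also have "\<dots> < (\<Sum>j\<in>J. card A)" using assms by (intro sum_strict_mono fin_J) auto
  finally show False by simp
qed

text \<open>If the group is cyclic over every \<open>cent i\<close>, a union bound over
  \<open>f\<close> suffices. Otherwise one noncyclic index \<open>i\<close> supplies a free
  \<open>cyc i w\<close> containing \<open>z i\<close>, and the union bound runs over the ring
  elements \<open>u\<close> instead, with \<open>f\<close> determined by \<open>u w\<close>.\<close>

theorem ex_common_translate:
  assumes z: "\<And>j. j \<in> J \<Longrightarrow> z j \<in> carrier G" and y: "\<And>j. j \<in> J \<Longrightarrow> y j \<in> carrier G"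
  shows "\<exists>f\<in>carrier G. \<forall>j\<in>J. \<forall>s\<in>S j. s (f \<otimes> y j) = f \<otimes> y j \<longrightarrow> s (z j) = z j"
proof (cases "\<forall>i\<in>J. \<exists>w\<in>carrier G. cyc i w = carrier G")
  case True
  show ?thesis
  proof (cases "J = {}")
    case False
    let ?B = "\<lambda>i. {f \<in> carrier G. \<exists>s\<in>S i. s (f \<otimes> y i) = f \<otimes> y i \<and> s (z i) \<noteq> z i}"
    have "\<exists>f\<in>carrier G. \<forall>i\<in>J. f \<notin> ?B i"
      using True card_stabilized_cyclic z y by (intro ex_avoiding[OF False fin]) blast
    then show ?thesis by blast
  qed auto
next
  case False
  then obtain i where i: "i \<in> J" "\<And>w. w \<in> carrier G \<Longrightarrow> cyc i w \<noteq> carrier G" by blast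
  then obtain w where w: "w \<in> carrier G" "z i \<in> cyc i w"
    "\<And>b v. \<lbrakk>b \<in> cent i; b w = \<one>; v \<in> carrier G\<rbrakk> \<Longrightarrow> b v = \<one>"
    using cyclic_or_free[OF i(1) z[OF i(1)]] by blast
  obtain \<pi> where \<pi>: "\<And>v. v \<in> carrier G \<Longrightarrow> \<pi> v \<in> cyc i w" "\<And>q. q \<in> cyc i w \<Longrightarrow> \<pi> q = q"
    "\<And>u v. \<lbrakk>u \<in> carrier G; v \<in> carrier G\<rbrakk> \<Longrightarrow> \<pi> (u \<otimes> v) = \<pi> u \<otimes> \<pi> v"
    "\<And>b v. \<lbrakk>b \<in> cent i; v \<in> carrier G\<rbrakk> \<Longrightarrow> \<pi> (b v) = b (\<pi> v)"
    using ex_projection[OF i(1) submod_cyc[OF i(1) w(1)]] by blast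
  note [simp] = y z i(1) w(1)
  \<comment> \<open>The projection turns the offset between \<open>y i\<close> and
    \<open>y j\<close> into a ring element \<open>a j\<close>, so that
    \<open>f \<otimes> y j\<close> projects to the value of \<open>plus u (a j)\<close> at
    \<open>w\<close>.\<close>
  have "\<exists>a\<in>cent i. a w = \<pi> (inv (y i) \<otimes> y j)" if "j \<in> J" for j
    using \<pi>(1)[of "inv (y i) \<otimes> y j"] that by (auto simp: cyc_def)
  then obtain a where a: "\<And>j. j \<in> J \<Longrightarrow> a j \<in> cent i \<and> a j w = \<pi> (inv (y i) \<otimes> y j)"
    by metis
  obtain T where T: "minimal_submod i T" using ex_minimal_submod[OF i(1) submod_whole[OF i(1)] nontriv] by blast
  \<comment> \<open>Offset zero at \<open>i\<close> itself: there \<open>u\<close> must be a unit,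
    elsewhere \<open>plus u (a j)\<close>.\<close>
  define d where "d j = (if j = i then (\<lambda>v\<in>carrier G. \<one>) else a j)" for j
  have d: "d j \<in> cent i" if "j \<in> J" for j using that a by (simp add: d_def)
  let ?B = "\<lambda>j. {u \<in> cent i. plus u (d j) \<in> singulars i T}"
  have "\<exists>u\<in>cent i. \<forall>j\<in>J. u \<notin> ?B j"
  proof (rule ex_avoiding)
    fix j assume j: "j \<in> J"
    have "inj_on (\<lambda>u. plus u (d j)) (cent i)"
    proof (rule inj_onI)
      fix u u' assume u: "u \<in> cent i" "u' \<in> cent i" "plus u (d j) = plus u' (d j)"
      have "u v = u' v" if "v \<in> carrier G" for v
        using fun_cong[OF u(3), of v] that u(1,2) d[OF j] by simp
      then show "u = u'" by (rule cent_eqI[OF u(1,2)])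
    qed
    then have "card (?B j) \<le> card (singulars i T)"
      by (intro card_inj_on_le[of "\<lambda>u. plus u (d j)"]) (auto elim: inj_on_subset)
    then have "card (?B j) * card J < card (cent i)"
      using card_singulars[OF i(1) T] by (meson le_less_trans mult_le_mono1)
    then show "?B j \<subseteq> cent i \<and> card (?B j) * card J < card (cent i)" by auto
  next
    show "J \<noteq> {}" using i(1) by blast
  qed (rule finite_cent)
  then obtain u where u: "u \<in> cent i" "\<And>j. j \<in> J \<Longrightarrow> plus u (d j) \<notin> singulars i T" by blast
  have ns: "\<exists>b\<in>cent i. \<forall>v\<in>carrier G. b (plus u (d j) v) = v" if "j \<in> J" for j
    using nonsingular_left_inverse[OF i(1) T _ u(2)[OF that]] u(1) d[OF that] i(1) by simp
  let ?f = "u w \<otimes> inv (y i)"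
  have fG: "?f \<in> carrier G" using u(1) by simp
  have "s (z j) = z j" if j: "j \<in> J" and s: "s \<in> S j" and sf: "s (?f \<otimes> y j) = ?f \<otimes> y j" for j s
  proof (cases "j = i")
    case True
    obtain b where b: "b \<in> cent i" "\<forall>v\<in>carrier G. b (plus u (d i) v) = v" using ns[OF i(1)] by blast
    have "\<forall>v\<in>carrier G. b (u v) = v" using b u(1) by (simp add: d_def)
    moreover have "s (u w) = u w" using sf True u(1) by (simp add: m_assoc)
    ultimately show ?thesis
      using left_inverse_fixes[OF i(1) _ b(1) u(1) _ w(1) _ w(2), of s] s True by simp
  next
    case False
    let ?s = "restrict s (carrier G)" and ?v = "plus u (a j)"
    have sc: "?s \<in> cent i" by (rule S_cent[OF i(1) j False s])
    have vc: "?v \<in> cent i" using u(1) a[OF j] i(1) by simp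
    have fj: "?f \<otimes> y j = u w \<otimes> (inv (y i) \<otimes> y j)" using u(1) j by (simp add: m_assoc)
    have "\<pi> (u w) = u w" using \<pi>(2) u(1) by (auto simp: cyc_def)
    then have "\<pi> (?f \<otimes> y j) = ?v w" using fj \<pi>(3) u(1) a[OF j] j by simp
    moreover have "?s (?f \<otimes> y j) = ?f \<otimes> y j" using sf u(1) j by simp
    ultimately have "?s (?v w) = ?v w" using \<pi>(4)[OF sc, of "?f \<otimes> y j"] fG j by simp
    \<comment> \<open>The ring element "\<open>?s\<close> times \<open>?v\<close> minus
      \<open>?v\<close>" kills \<open>w\<close>. Freeness of \<open>cyc i w\<close> makes it zero,
      so \<open>s\<close> fixes the whole image of \<open>?v\<close>.\<close>
    then have 1: "plus (compose (carrier G) ?s ?v) (neg ?v) w = \<one>"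
      using w(1) cent_closed[OF vc w(1)]
      by (simp add: plus_apply[of _ "compose (carrier G) ?s ?v"] compose_eq del: plus_apply)
    have 2: "s (?v x) = ?v x" if x: "x \<in> carrier G" for x
    proof -
      have "plus (compose (carrier G) ?s ?v) (neg ?v) x = \<one>"
        by (rule w(3)[where b = "plus (compose (carrier G) ?s ?v) (neg ?v)"])
          (use x 1 plus_cent[OF i(1) comp_cent[OF i(1) sc vc] neg_cent[OF i(1) vc]] in blast)+
      then have "s (?v x) \<otimes> inv (?v x) = \<one>"
        using x cent_closed[OF vc x]
        by (simp add: plus_apply[of _ "compose (carrier G) ?s ?v"] compose_eq del: plus_apply)
      moreover have "?v x \<in> carrier G" "s (?v x) \<in> carrier G"
        using vc x j s S_closed cent_closed by blast+
      ultimately show ?thesis using mult_inv_eq_one_iff[of "s (?v x)" "?v x"] by simp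
    qed
    \<comment> \<open>As a unit, \<open>?v\<close> is surjective; hence \<open>s\<close> acts
      trivially on the entire group, and in particular fixes \<open>z j\<close>.\<close>
    obtain b where "b \<in> cent i" "\<forall>v\<in>carrier G. b (?v v) = v"
      using ns[OF j] False by (auto simp: d_def)
    then have "inj_on ?v (carrier G)" by (intro inj_on_inverseI[of _ b]) auto
    then have "?v ` carrier G = carrier G"
      using fin vc cent_closed by (intro endo_inj_surj) blast+
    then obtain x where "x \<in> carrier G" "z j = ?v x" using z[OF j] by blast
    then show ?thesis using 2 by simp
  qed
  then show ?thesis using fG by blast
qed

end

subsection \<open>Fixed points of \<open>p\<close>-groups\<close>

lemma (in group) group_action_restrictI:
  assumes "\<And>g x. \<lbrakk>g \<in> carrier G; x \<in> E\<rbrakk> \<Longrightarrow> f g x \<in> E"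
    and "\<And>x. x \<in> E \<Longrightarrow> f \<one> x = x"
    and "\<And>g h x. \<lbrakk>g \<in> carrier G; h \<in> carrier G; x \<in> E\<rbrakk> \<Longrightarrow> f (g \<otimes> h) x = f g (f h x)"
  shows "group_action G E (\<lambda>g. restrict (f g) E)"
proof -
  have bij: "restrict (f g) E \<in> Bij E" if g: "g \<in> carrier G" for g
  proof -
    have "f (inv g) (f g x) = x" "f g (f (inv g) x) = x" if "x \<in> E" for x
      using assms(3)[OF inv_closed[OF g] g that] assms(3)[OF g inv_closed[OF g] that]
        assms(2)[OF that] g by simp_all
    then have "bij_betw (f g) E E"
      using assms(1) g by (intro bij_betw_byWitness[where f' = "f (inv g)"]) auto
    then show ?thesis by (simp add: Bij_def)
  qed
  then have "(\<lambda>g. restrict (f g) E) \<in> hom G (BijGroup E)"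
    using assms(1,3) by (intro homI) (auto simp: BijGroup_def compose_def fun_eq_iff)
  then show ?thesis
    by (simp add: group_action_def group_hom_def group_hom_axioms_def group_BijGroup is_group)
qed

text \<open>Orbit lengths divide \<open>p ^ k\<close>, so every orbit that is not a single fixed
  point has length divisible by \<open>p\<close>.\<close>

lemma (in group_action) card_mod_fixed_points:
  assumes p: "Factorial_Ring.prime (p::nat)" and ord: "order G = p ^ k" and fin: "finite E"
  shows "card E mod p = card {x \<in> E. \<forall>g\<in>carrier G. \<phi> g x = x} mod p"
proof -
  let ?F = "{x \<in> E. \<forall>g\<in>carrier G. \<phi> g x = x}"
  let ?O = "orbits G E \<phi>"
  let ?O1 = "(\<lambda>x. {x}) ` ?F"
  interpret G: group G using group_hom group_hom.axioms(1) by blast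
  have single: "orbit G \<phi> x = {x}" if "x \<in> ?F" for x
  proof -
    have "orbit G \<phi> x = (\<lambda>g. x) ` carrier G"
      using that unfolding orbit_def Setcompr_eq_image by (intro image_cong) auto
    then show ?thesis using G.one_closed by auto
  qed
  have finO: "finite ?O"
    using fin by (simp add: orbits_def Setcompr_eq_image)
  have "?O1 \<subseteq> ?O" using single unfolding orbits_def by blast
  have "card E = (\<Sum>orb\<in>?O. card orb)"
    using disjoint_sum[OF fin, of "\<lambda>_. 1 :: nat"] by simp
  also have "\<dots> = (\<Sum>orb\<in>?O - ?O1. card orb) + (\<Sum>orb\<in>?O1. card orb)"
    by (rule sum.subset_diff[OF \<open>?O1 \<subseteq> ?O\<close> finO])
  also have "(\<Sum>orb\<in>?O1. card orb) = card ?F"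
    by (subst sum.reindex) (auto simp: inj_on_def)
  finally have E: "card E = (\<Sum>orb\<in>?O - ?O1. card orb) + card ?F" .
  have "p dvd card orb" if orb: "orb \<in> ?O - ?O1" for orb
  proof -
    obtain x where x: "x \<in> E" "orb = orbit G \<phi> x" using orb by (auto simp: orbits_def)
    have "card orb dvd p ^ k"
      using orbit_stabilizer_theorem[OF x(1)] ord x(2) by (metis dvd_triv_left)
    then obtain m where m: "card orb = p ^ m" using p divides_primepow_nat by blast
    show ?thesis
    proof (cases "m = 0")
      case True
      then obtain y where "orb = {y}" using m card_1_singletonE by auto
      moreover have "x \<in> orb" using x orbit_refl by simp
      ultimately have "orb = {x}" by simp
      then have "\<forall>g\<in>carrier G. \<phi> g x = x" using x(2) unfolding orbit_def by blast
      then have "orb \<in> ?O1" using x(1) \<open>orb = {x}\<close> by blast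
      then show ?thesis using orb by blast
    qed (simp add: m)
  qed
  then have "p dvd (\<Sum>orb\<in>?O - ?O1. card orb)" by (rule dvd_sum)
  then show ?thesis using E by (auto elim!: dvdE)
qed

text \<open>The centre is the fixed point set of conjugation, so \<open>p\<close> divides its
  cardinality.\<close>

lemma (in group) p_group_center_nontrivial:
  assumes p: "Factorial_Ring.prime (p::nat)" and ord: "order G = p ^ k" "order G \<noteq> 1"
  shows "\<exists>z\<in>carrier G. z \<noteq> \<one> \<and> (\<forall>g\<in>carrier G. g \<otimes> z = z \<otimes> g)"
proof -
  interpret A: group_action G "carrier G" "\<lambda>g. \<lambda>h\<in>carrier G. g \<otimes> h \<otimes> inv g"
    by (rule action_by_conjugation)
  have fin: "finite (carrier G)"
    using ord(1) p prime_gt_0_nat order_gt_0_iff_finite by simp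
  let ?F = "{x \<in> carrier G. \<forall>g\<in>carrier G. (\<lambda>h\<in>carrier G. g \<otimes> h \<otimes> inv g) x = x}"
  have "k \<noteq> 0" using ord by auto
  then have "card (carrier G) mod p = 0" using ord(1) by (simp add: order_def)
  then have "p dvd card ?F" using A.card_mod_fixed_points[OF p ord(1) fin] by (simp add: dvd_eq_mod_eq_0)
  moreover have "\<one> \<in> ?F" by simp
  moreover have "finite ?F" using fin by simp
  ultimately have "1 < card ?F"
    by (metis (no_types, lifting) card_gt_0_iff dvd_imp_le emptyE order_less_le_trans p prime_gt_1_nat)
  then have "?F \<noteq> {\<one>}" by force
  then obtain z where z: "z \<in> ?F" "z \<noteq> \<one>" using \<open>\<one> \<in> ?F\<close> by blast
  have "g \<otimes> z = z \<otimes> g" if "g \<in> carrier G" for g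
  proof -
    have "g \<otimes> z \<otimes> inv g = z" using z that by auto
    then show ?thesis using z that by (metis (no_types, lifting) inv_solve_right' m_closed mem_Collect_eq)
  qed
  then show ?thesis using z by blast
qed

text \<open>A representative of a nontrivial central element of the quotient. Later \<open>N\<close>
  is the kernel of an action, so \<open>c\<close> acts nontrivially and commutes with the whole
  group as an operator.\<close>

lemma (in group) p_group_central_mod_normal:
  assumes p: "Factorial_Ring.prime (p::nat)" and ord: "order G = p ^ k"
    and N: "N \<lhd> G" "N \<noteq> carrier G"
  shows "\<exists>c\<in>carrier G - N. \<forall>g\<in>carrier G. g \<otimes> c \<otimes> inv (c \<otimes> g) \<in> N"
proof -
  interpret N: normal N G by fact
  interpret Q: group "G Mod N" by (rule N.factorgroup_is_group)
  have "card (rcosets N) * card N = p ^ k" using lagrange[OF N.subgroup_axioms] ord by simp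
  then have "order (G Mod N) dvd p ^ k"
    by (metis dvd_triv_left order_def partial_object.select_convs(1) FactGroup_def)
  then obtain m where m: "order (G Mod N) = p ^ m" using p divides_primepow_nat by blast
  have fin: "finite (carrier G)"
    using ord p prime_gt_0_nat order_gt_0_iff_finite by simp
  have "order (G Mod N) \<noteq> 1" using N.fact_group_trivial_iff[OF fin] N(2)
    by (metis Q.order_one_triv_iff)
  then obtain z where z: "z \<in> carrier (G Mod N)" "z \<noteq> \<one>\<^bsub>G Mod N\<^esub>"
    "\<forall>g\<in>carrier (G Mod N). g \<otimes>\<^bsub>G Mod N\<^esub> z = z \<otimes>\<^bsub>G Mod N\<^esub> g"
    using Q.p_group_center_nontrivial[OF p m] by blast
  obtain c where c: "c \<in> carrier G" "z = N #> c" using z(1) by (auto simp: carrier_FactGroup)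
  have "c \<notin> N" using c z(2) coset_join2[OF c(1) N.subgroup_axioms] by auto
  moreover have "g \<otimes> c \<otimes> inv (c \<otimes> g) \<in> N" if g: "g \<in> carrier G" for g
  proof -
    have "N #> g \<in> carrier (G Mod N)" using g by (auto simp: carrier_FactGroup)
    then have "(N #> g) <#> (N #> c) = (N #> c) <#> (N #> g)" using z(3) c by simp
    then have "N #> (g \<otimes> c) = N #> (c \<otimes> g)" using g c by (simp add: N.rcos_sum)
    then have "g \<otimes> c \<in> N #> (c \<otimes> g)" using g c rcos_self[OF _ N.subgroup_axioms] m_closed by metis
    then show ?thesis using g c N.rcos_module_imp[OF is_group] by simp
  qed
  ultimately show ?thesis using c by blast
qed

section \<open>Conjugating \<open>p\<close>-subgroups, and coprime powers\<close>

text \<open>\<open>P\<close> acts on the cosets of \<open>Q\<close>, whose number is prime to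
  \<open>p\<close>, so some coset \<open>Q #> g\<close> is fixed; this says that \<open>g\<close>
  conjugates \<open>P\<close> into \<open>Q\<close>.\<close>

lemma (in group) p_subgroup_conj_into:
  assumes p: "Factorial_Ring.prime (p::nat)" and fin: "finite (carrier G)"
    and P: "subgroup P G" "card P = p ^ k"
    and Q: "subgroup Q G" "\<not> p dvd order G div card Q"
  shows "\<exists>g\<in>carrier G. \<forall>x\<in>P. g \<otimes> x \<otimes> inv g \<in> Q"
proof -
  interpret Q: subgroup Q G by fact
  let ?E = "rcosets Q"
  have "group_action G ?E (\<lambda>g. restrict (\<lambda>C. C #> inv g) ?E)"
  proof (rule group_action_restrictI)
    fix C assume "C \<in> ?E"
    then have C: "C \<subseteq> carrier G" using Q.rcosets_carrier[OF is_group] by blast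
    show "C #> inv \<one> = C" using C by simp
    fix g h assume gh: "g \<in> carrier G" "h \<in> carrier G"
    show "C #> inv (g \<otimes> h) = C #> inv h #> inv g"
      using C gh by (simp add: inv_mult_group coset_mult_assoc)
  next
    fix g C assume "g \<in> carrier G" "C \<in> ?E"
    then show "C #> inv g \<in> ?E"
      using Q.subset by (auto simp: RCOSETS_def coset_mult_assoc)
  qed
  then interpret A: group_action "G\<lparr>carrier := P\<rparr>" ?E "\<lambda>g. restrict (\<lambda>C. C #> inv g) ?E"
    by (rule group_action.induced_action[OF _ P(1)])
  have "card ?E * card Q = order G" using lagrange[OF Q(1)] .
  moreover have "card Q \<noteq> 0" using Q.subset Q.one_closed fin finite_subset by (metis card_0_eq empty_iff)
  ultimately have cE: "card ?E = order G div card Q" by (metis nonzero_mult_div_cancel_right)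
  have finE: "finite ?E" using fin by (simp add: RCOSETS_def)
  have ordP: "order (G\<lparr>carrier := P\<rparr>) = p ^ k" using P by (simp add: order_def)
  let ?F = "{C \<in> ?E. \<forall>g\<in>carrier (G\<lparr>carrier := P\<rparr>). restrict (\<lambda>C. C #> inv g) ?E C = C}"
  have "card ?F mod p \<noteq> 0"
    using A.card_mod_fixed_points[OF p ordP finE] Q(2)[folded cE] dvd_eq_mod_eq_0 by metis
  then have "?F \<noteq> {}" by (metis card.empty mod_0)
  then obtain C where C: "C \<in> ?E" "\<forall>g\<in>P. C #> inv g = C" by auto
  then obtain g where g: "g \<in> carrier G" "C = Q #> g" by (auto simp: RCOSETS_def)
  have "g \<otimes> x \<otimes> inv g \<in> Q" if x: "x \<in> P" for x
  proof -
    have xG: "x \<in> carrier G" using x P(1) subgroup.mem_carrier by fast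
    have "inv x \<in> P" using x P(1) subgroup.m_inv_closed by fast
    then have "Q #> g #> x = Q #> g" using C(2) g xG by (metis inv_inv)
    then have "Q #> (g \<otimes> x) = Q #> g" using coset_mult_assoc[OF Q.subset g(1) xG] by simp
    then have "g \<otimes> x \<in> Q #> g" using rcos_self[OF _ Q(1)] g xG by (metis m_closed)
    then show ?thesis using Q.rcos_module_imp[OF is_group g(1)] by blast
  qed
  then show ?thesis using g by blast
qed

lemma (in group) p_subgroup_conj_into_within:
  assumes p: "Factorial_Ring.prime (p::nat)" and fin: "finite (carrier G)"
    and R: "subgroup R G"
    and P: "subgroup P G" "P \<subseteq> R" "card P = p ^ k"
    and Q: "subgroup Q G" "Q \<subseteq> R" "\<not> p dvd card R div card Q"
  shows "\<exists>g\<in>R. \<forall>x\<in>P. g \<otimes> x \<otimes> inv g \<in> Q"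
proof -
  interpret R: group "G\<lparr>carrier := R\<rparr>" using subgroup_imp_group[OF R] .
  have "\<exists>g\<in>carrier (G\<lparr>carrier := R\<rparr>). \<forall>x\<in>P.
      g \<otimes>\<^bsub>G\<lparr>carrier := R\<rparr>\<^esub> x \<otimes>\<^bsub>G\<lparr>carrier := R\<rparr>\<^esub> inv\<^bsub>G\<lparr>carrier := R\<rparr>\<^esub> g \<in> Q"
    using assms subgroup.subset[OF R] finite_subset
    by (intro R.p_subgroup_conj_into[OF p]) (auto simp: order_def intro: subgroup_incl)
  then show ?thesis using m_inv_consistent[OF R] by auto
qed

text \<open>Bezout writes \<open>x\<close> as a product of powers of the two given elements. If one
  exponent is 0, coprimality makes the other 1.\<close>

lemma (in group) subgroup_coprime_powers:
  assumes K: "subgroup K G" and x: "x \<in> carrier G"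
    and m: "x [^] (m::nat) \<in> K" and n: "x [^] (n::nat) \<in> K" and "coprime m n"
  shows "x \<in> K"
proof -
  have pow: "y [^] (l::nat) \<in> K" if "y \<in> K" for y l
    using that K by (induction l) (auto simp: subgroup.one_closed subgroup.m_closed)
  show ?thesis
  proof (cases "n = 0")
    case True
    then show ?thesis using m x \<open>coprime m n\<close> by simp
  next
    case False
    show ?thesis
    proof (cases "m = 0")
      case True
      then show ?thesis using n x \<open>coprime m n\<close> by simp
    next
      case m0: False
      obtain u v where "m * u = n * v + 1"
        using bezout_nat[OF m0, of n] \<open>coprime m n\<close> by auto
      then have "x [^] (m * u) = x [^] (n * v) \<otimes> x" by simp
      then have "(x [^] m) [^] u = (x [^] n) [^] v \<otimes> x" using x by (simp add: nat_pow_pow)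
      then have "x = inv ((x [^] n) [^] v) \<otimes> (x [^] m) [^] u"
        using x by (simp add: m_assoc[symmetric])
      then show ?thesis using pow m n K by (metis subgroup.m_closed subgroup.m_inv_closed)
    qed
  qed
qed

subsection \<open>Abelian minimal normal subgroups\<close>

text \<open>Conjugation from the left, hence a left action, although \<open>conj_subgroup\<close>
  conjugates from the right; \<open>conj_subgroup_eq\<close> translates between them.\<close>

definition (in group) cj :: "'a \<Rightarrow> 'a \<Rightarrow> 'a" where
  "cj g x = g \<otimes> x \<otimes> inv g"

context group
begin

lemma cj_closed [simp]: "\<lbrakk>g \<in> carrier G; x \<in> carrier G\<rbrakk> \<Longrightarrow> cj g x \<in> carrier G"
  by (simp add: cj_def)

lemma cj_mult: "\<lbrakk>g \<in> carrier G; x \<in> carrier G; y \<in> carrier G\<rbrakk> \<Longrightarrow> cj g (x \<otimes> y) = cj g x \<otimes> cj g y"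
  by (simp add: cj_def m_assoc[symmetric]) (simp add: m_assoc)

lemma cj_cj: "\<lbrakk>g \<in> carrier G; h \<in> carrier G; x \<in> carrier G\<rbrakk> \<Longrightarrow> cj g (cj h x) = cj (g \<otimes> h) x"
  by (simp add: cj_def m_assoc inv_mult_group)

lemma cj_one_left [simp]: "x \<in> carrier G \<Longrightarrow> cj \<one> x = x"
  by (simp add: cj_def)

lemma cj_one [simp]: "g \<in> carrier G \<Longrightarrow> cj g \<one> = \<one>"
  by (simp add: cj_def)

lemma cj_inv: "\<lbrakk>g \<in> carrier G; x \<in> carrier G\<rbrakk> \<Longrightarrow> cj g (inv x) = inv (cj g x)"
  by (simp add: cj_def inv_mult_group m_assoc)

lemma cj_cancel [simp]:
  assumes "g \<in> carrier G" "x \<in> carrier G"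
  shows "cj (inv g) (cj g x) = x" "cj g (cj (inv g) x) = x"
  using assms by (simp_all add: cj_cj)

lemma cj_eq_one_iff: "\<lbrakk>g \<in> carrier G; x \<in> carrier G\<rbrakk> \<Longrightarrow> cj g x = \<one> \<longleftrightarrow> x = \<one>"
  by (metis cj_cancel(1) cj_one inv_closed)

lemma cj_fix_iff: "\<lbrakk>g \<in> carrier G; x \<in> carrier G\<rbrakk> \<Longrightarrow> cj g x = x \<longleftrightarrow> g \<otimes> x = x \<otimes> g"
  unfolding cj_def by (metis inv_solve_right' m_closed)

lemma cj_fix_sym: "\<lbrakk>g \<in> carrier G; x \<in> carrier G\<rbrakk> \<Longrightarrow> cj g x = x \<longleftrightarrow> cj x g = g"
  using cj_fix_iff[of g x] cj_fix_iff[of x g] by auto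

lemma normal_cj: "\<lbrakk>N \<lhd> G; g \<in> carrier G; x \<in> N\<rbrakk> \<Longrightarrow> cj g x \<in> N"
  unfolding cj_def by (rule normal.inv_op_closed2)

lemma normalI_cj:
  assumes "subgroup N G" "\<And>g x. \<lbrakk>g \<in> carrier G; x \<in> N\<rbrakk> \<Longrightarrow> cj g x \<in> N"
  shows "N \<lhd> G"
  using assms normal_inv_iff unfolding cj_def by blast

lemma mult_pow_normal:
  assumes N: "N \<lhd> G" and s: "s \<in> carrier G" and v: "v \<in> N"
  shows "\<exists>w\<in>N. (s \<otimes> v) [^] (n::nat) = s [^] n \<otimes> w"
proof (induction n)
  case 0
  have "\<one> \<in> N" using N normal_imp_subgroup subgroup.one_closed by blast
  then show ?case by force
next
  case (Suc n)
  interpret N: normal N G by fact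
  obtain w where w: "w \<in> N" "(s \<otimes> v) [^] n = s [^] n \<otimes> w" using Suc by blast
  have [simp]: "w \<in> carrier G" "v \<in> carrier G" using w v by simp_all
  have "(s \<otimes> v) [^] Suc n = s [^] Suc n \<otimes> ((inv s \<otimes> w \<otimes> s) \<otimes> v)"
    using w(2) s by (simp add: m_assoc) (simp add: m_assoc[symmetric])
  moreover have "(inv s \<otimes> w \<otimes> s) \<otimes> v \<in> N"
    using N.inv_op_closed1[OF s w(1)] v by simp
  ultimately show ?case by blast
qed

lemma subgroup_pow_card:
  assumes "subgroup S G" "s \<in> S"
  shows "s [^] card S = \<one>"
proof -
  interpret S: group "G\<lparr>carrier := S\<rparr>" using subgroup_imp_group[OF assms(1)] .
  have "s [^]\<^bsub>G\<lparr>carrier := S\<rparr>\<^esub> order (G\<lparr>carrier := S\<rparr>) = \<one>"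
    using S.pow_order_eq_1[of s] assms by simp
  then show ?thesis by (simp add: order_def nat_pow_consistent[symmetric])
qed

end

text \<open>In the application \<open>R i\<close> is the core of \<open>P i <#> V\<close>, and
  \<open>S i\<close> its intersection with \<open>P i\<close>. The \<open>p i\<close>-group
  \<open>S i\<close> need not be normal but \<open>R i\<close> is, and both induce the same maps on
  \<open>V\<close>.\<close>

locale coprime_normal_sections = group +
  fixes V :: "'a set" and I :: "'i set" and p k :: "'i \<Rightarrow> nat" and S R :: "'i \<Rightarrow> 'a set"
  assumes fin: "finite (carrier G)"
    and V_normal: "V \<lhd> G" and V_comm: "\<lbrakk>v \<in> V; w \<in> V\<rbrakk> \<Longrightarrow> v \<otimes> w = w \<otimes> v"
    and V_nontriv: "V \<noteq> {\<one>}"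
    and V_minimal: "\<lbrakk>N \<lhd> G; N \<subseteq> V\<rbrakk> \<Longrightarrow> N = {\<one>} \<or> N = V"
    and fin_I: "finite I"
    and prime_p: "i \<in> I \<Longrightarrow> Factorial_Ring.prime (p i)" and inj_p: "inj_on p I"
    and R_normal: "i \<in> I \<Longrightarrow> R i \<lhd> G"
    and S_subgroup: "i \<in> I \<Longrightarrow> subgroup (S i) G" and S_card: "i \<in> I \<Longrightarrow> card (S i) = p i ^ k i"
    and S_R: "i \<in> I \<Longrightarrow> S i \<subseteq> R i"
    and R_decomp: "\<lbrakk>i \<in> I; r \<in> R i\<rbrakk> \<Longrightarrow> \<exists>s\<in>S i. \<exists>v\<in>V. r = s \<otimes> v"
begin

lemma V_subgroup: "subgroup V G" using V_normal normal_imp_subgroup by blast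

lemma V_carrier [simp]: "v \<in> V \<Longrightarrow> v \<in> carrier G"
  using V_subgroup subgroup.mem_carrier by fast

lemma R_carrier: "\<lbrakk>i \<in> I; r \<in> R i\<rbrakk> \<Longrightarrow> r \<in> carrier G"
  using R_normal normal_imp_subgroup subgroup.mem_carrier by fast

lemma S_carrier: "\<lbrakk>i \<in> I; s \<in> S i\<rbrakk> \<Longrightarrow> s \<in> carrier G"
  using R_carrier S_R by blast

lemma V_acts_trivially: "\<lbrakk>v \<in> V; w \<in> V\<rbrakk> \<Longrightarrow> cj v w = w"
  using V_comm by (simp add: cj_fix_iff)

lemma R_acts_as_S: "\<lbrakk>i \<in> I; r \<in> R i\<rbrakk> \<Longrightarrow> \<exists>s\<in>S i. \<forall>w\<in>V. cj r w = cj s w"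
  using R_decomp[of i r] S_carrier
  by (metis V_acts_trivially V_carrier cj_cj)

lemma R_pow: "\<lbrakk>i \<in> I; r \<in> R i\<rbrakk> \<Longrightarrow> r [^] (p i ^ k i) \<in> V"
proof -
  assume i: "i \<in> I" and "r \<in> R i"
  then obtain s v where r: "s \<in> S i" "v \<in> V" "r = s \<otimes> v" using R_decomp by blast
  obtain w where "w \<in> V" "r [^] (p i ^ k i) = s [^] (p i ^ k i) \<otimes> w"
    using mult_pow_normal[OF V_normal S_carrier[OF i r(1)] r(2)] r(3) by blast
  then show ?thesis using subgroup_pow_card[OF S_subgroup[OF i] r(1)] S_card[OF i] by simp
qed

lemma coprime_p: "\<lbrakk>i \<in> I; j \<in> I; i \<noteq> j\<rbrakk> \<Longrightarrow> coprime (p i ^ k i) (p j ^ k j)"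
  using inj_p prime_p by (metis coprime_power_left_iff coprime_power_right_iff inj_on_eq_iff primes_coprime)

lemma R_Int_R: "\<lbrakk>i \<in> I; j \<in> I; i \<noteq> j\<rbrakk> \<Longrightarrow> R i \<inter> R j \<subseteq> V"
  using subgroup_coprime_powers[OF V_subgroup] R_pow R_carrier coprime_p by (metis IntE subsetI)

text \<open>The commutator of \<open>a\<close> and \<open>b\<close> lies in
  \<open>R i \<inter> R j\<close>, hence in \<open>V\<close>, and acts trivially because
  \<open>V\<close> is abelian.\<close>

lemma R_comm:
  assumes ij: "i \<in> I" "j \<in> I" "i \<noteq> j" and ab: "a \<in> R i" "b \<in> R j" and w: "w \<in> V"
  shows "cj a (cj b w) = cj b (cj a w)"
proof -
  have [simp]: "a \<in> carrier G" "b \<in> carrier G" "w \<in> carrier G" using assms R_carrier by auto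
  interpret Ri: normal "R i" G using R_normal[OF ij(1)] .
  interpret Rj: normal "R j" G using R_normal[OF ij(2)] .
  let ?c = "inv a \<otimes> inv b \<otimes> a \<otimes> b"
  have "?c = inv a \<otimes> (inv b \<otimes> a \<otimes> b)" by (simp add: m_assoc)
  then have "?c \<in> R i" using Ri.inv_op_closed1[of b a] ab by simp
  moreover have "?c \<in> R j" using Rj.inv_op_closed1[of a "inv b"] ab by simp
  ultimately have "?c \<in> V" using R_Int_R[OF ij] by blast
  have "a \<otimes> b = (b \<otimes> a) \<otimes> ?c" by (simp add: m_assoc) (simp add: m_assoc[symmetric])
  then have "cj a (cj b w) = cj (b \<otimes> a) (cj ?c w)" by (simp add: cj_cj)
  also have "\<dots> = cj b (cj a w)" using V_acts_trivially[OF \<open>?c \<in> V\<close> w] by (simp add: cj_cj)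
  finally show ?thesis .
qed

section \<open>Invariant subgroups of \<open>V\<close> and their translates\<close>

text \<open>Invariance is required under \<open>R i\<close> rather than \<open>S i\<close>: since
  \<open>R i\<close> is normal, conjugates of invariant subgroups stay invariant.\<close>

definition invar :: "'a set \<Rightarrow> bool" where
  "invar U \<longleftrightarrow> subgroup U G \<and> U \<subseteq> V \<and> (\<forall>i\<in>I. \<forall>r\<in>R i. \<forall>u\<in>U. cj r u \<in> U)"

definition min_invar :: "'a set \<Rightarrow> bool" where
  "min_invar W \<longleftrightarrow> invar W \<and> W \<noteq> {\<one>} \<and> (\<forall>U. invar U \<longrightarrow> U \<subseteq> W \<longrightarrow> U = {\<one>} \<or> U = W)"

definition translatable :: "'a set \<Rightarrow> bool" where
  "translatable Y \<longleftrightarrow> (\<forall>z y. (\<forall>i\<in>I. z i \<in> Y \<and> y i \<in> Y) \<longrightarrow>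
     (\<exists>f\<in>Y. \<forall>i\<in>I. \<forall>s\<in>S i. cj s (f \<otimes> y i) = f \<otimes> y i \<longrightarrow> cj s (z i) = z i))"

lemma translatableD:
  assumes "translatable U" "\<And>i. i \<in> I \<Longrightarrow> z i \<in> U" "\<And>i. i \<in> I \<Longrightarrow> y i \<in> U"
  shows "\<exists>f\<in>U. \<forall>i\<in>I. \<forall>s\<in>S i. cj s (f \<otimes> y i) = f \<otimes> y i \<longrightarrow> cj s (z i) = z i"
  using assms by (simp add: translatable_def)

lemma invar_subgroup: "invar U \<Longrightarrow> subgroup U G" by (simp add: invar_def)

lemma invar_V: "\<lbrakk>invar U; u \<in> U\<rbrakk> \<Longrightarrow> u \<in> V" by (auto simp: invar_def)

lemma invar_cj: "\<lbrakk>invar U; i \<in> I; r \<in> R i; u \<in> U\<rbrakk> \<Longrightarrow> cj r u \<in> U" by (simp add: invar_def)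

lemma invar_Int: "\<lbrakk>invar U; invar W\<rbrakk> \<Longrightarrow> invar (U \<inter> W)"
  unfolding invar_def by (auto intro: subgroups_Inter_pair)

text \<open>\<open>?N\<close> is the kernel of the action of \<open>S i\<close> on \<open>W\<close>;
  the element sought represents a nontrivial central element of the quotient of \<open>S i\<close>
  by \<open>?N\<close>.\<close>

lemma ex_central_on:
  assumes W: "invar W" and i: "i \<in> I" and act: "\<exists>s\<in>S i. \<exists>w\<in>W. cj s w \<noteq> w"
  shows "\<exists>c\<in>S i. (\<exists>w\<in>W. cj c w \<noteq> w) \<and> (\<forall>s\<in>S i. \<forall>w\<in>W. cj s (cj c w) = cj c (cj s w))"
proof -
  let ?N = "{s \<in> S i. \<forall>w\<in>W. cj s w = w}"
  note [simp] = S_carrier[OF i] V_carrier[OF invar_V[OF W]]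
  note SG = S_subgroup[OF i]
  interpret S: group "G\<lparr>carrier := S i\<rparr>" using subgroup_imp_group[OF SG] .
  have SW: "cj s w \<in> W" if "s \<in> S i" "w \<in> W" for s w
    using invar_cj[OF W i _ that(2)] S_R[OF i] that(1) by blast
  have cj_inv_fix: "cj (inv s) w = w" if "s \<in> S i" "w \<in> W" "cj s w = w" for s w
    using cj_cancel(1)[of s w] that by simp
  have "subgroup ?N (G\<lparr>carrier := S i\<rparr>)"
  proof (rule S.subgroupI)
    show "?N \<noteq> {}" using subgroup.one_closed[OF SG] by force
    fix a assume a: "a \<in> ?N"
    then show "inv\<^bsub>G\<lparr>carrier := S i\<rparr>\<^esub> a \<in> ?N"
      using cj_inv_fix m_inv_consistent[OF SG] subgroup.m_inv_closed[OF SG] by auto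
    fix b assume b: "b \<in> ?N"
    show "a \<otimes>\<^bsub>G\<lparr>carrier := S i\<rparr>\<^esub> b \<in> ?N"
      using a b subgroup.m_closed[OF SG] by (auto simp: cj_cj[symmetric])
  qed auto
  moreover have "x \<otimes> h \<otimes> inv x \<in> ?N" if x: "x \<in> S i" and h: "h \<in> ?N" for x h
  proof -
    have "cj (x \<otimes> h \<otimes> inv x) w = w" if w: "w \<in> W" for w
    proof -
      have "inv x \<in> S i" using x subgroup.m_inv_closed[OF SG] by blast
      then have "cj h (cj (inv x) w) = cj (inv x) w" using SW[of "inv x" w] h w by blast
      moreover have "cj (x \<otimes> h \<otimes> inv x) w = cj x (cj h (cj (inv x) w))"
        using x h w by (simp add: cj_cj m_assoc)
      ultimately show ?thesis using x w by simp
    qed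
    then show ?thesis
      using x h subgroup.m_closed[OF SG] subgroup.m_inv_closed[OF SG] by auto
  qed
  ultimately have nN: "?N \<lhd> (G\<lparr>carrier := S i\<rparr>)"
    using S.normal_inv_iff m_inv_consistent[OF SG] by auto
  have neN: "?N \<noteq> carrier (G\<lparr>carrier := S i\<rparr>)" using act by auto
  have "order (G\<lparr>carrier := S i\<rparr>) = p i ^ k i" using S_card[OF i] by (simp add: order_def)
  from S.p_group_central_mod_normal[OF prime_p[OF i] this nN neN] obtain c where c: "c \<in> S i - ?N"
    "\<And>g. g \<in> S i \<Longrightarrow> g \<otimes> c \<otimes> inv\<^bsub>G\<lparr>carrier := S i\<rparr>\<^esub> (c \<otimes> g) \<in> ?N"
    unfolding partial_object.select_convs partial_object.update_convs monoid.select_convs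
    by (elim bexE) (rule that, simp, drule bspec, simp_all)
  have "cj s (cj c w) = cj c (cj s w)" if s: "s \<in> S i" and w: "w \<in> W" for s w
  proof -
    have cs: "c \<otimes> s \<in> S i" using c s subgroup.m_closed[OF SG] by blast
    have "s \<otimes> c \<otimes> inv (c \<otimes> s) \<in> ?N" using c(2)[OF s] m_inv_consistent[OF SG cs] by simp
    moreover have "cj (c \<otimes> s) w \<in> W" by (rule SW[OF cs w])
    ultimately have "cj (s \<otimes> c \<otimes> inv (c \<otimes> s)) (cj (c \<otimes> s) w) = cj (c \<otimes> s) w" by blast
    moreover have "cj (s \<otimes> c \<otimes> inv (c \<otimes> s)) (cj (c \<otimes> s) w) = cj (s \<otimes> c) w"
      using c s w cs by (simp add: cj_cj m_assoc)
    ultimately show ?thesis using c s w by (simp add: cj_cj)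
  qed
  then show ?thesis using c(1) by blast
qed

lemma min_invar_translatable:
  assumes W: "min_invar W"
  shows "translatable W"
  unfolding translatable_def
proof (intro allI impI)
  fix z y assume zy: "\<forall>i\<in>I. z i \<in> W \<and> y i \<in> W"
  have iW: "invar W" "W \<noteq> {\<one>}" using W by (auto simp: min_invar_def)
  note WG = invar_subgroup[OF iW(1)]
  note [simp] = invar_V[OF iW(1)]
  \<comment> \<open>Indices acting trivially on \<open>W\<close> impose no condition, since then
    \<open>cj s (z i) = z i\<close> always holds.\<close>
  define J where "J = {i \<in> I. \<exists>s\<in>S i. \<exists>w\<in>W. cj s w \<noteq> w}"
  have "\<forall>i\<in>J. \<exists>c\<in>S i. (\<exists>w\<in>W. cj c w \<noteq> w) \<and> (\<forall>s\<in>S i. \<forall>w\<in>W. cj s (cj c w) = cj c (cj s w))"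
    using ex_central_on[OF iW(1)] by (auto simp: J_def)
  then obtain c where c: "\<And>i. i \<in> J \<Longrightarrow> c i \<in> S i" "\<And>i. i \<in> J \<Longrightarrow> \<exists>w\<in>W. cj (c i) w \<noteq> w"
    "\<And>i s w. \<lbrakk>i \<in> J; s \<in> S i; w \<in> W\<rbrakk> \<Longrightarrow> cj s (cj (c i) w) = cj (c i) (cj s w)"
    by metis
  have JI: "i \<in> I" if "i \<in> J" for i using that by (simp add: J_def)
  have SW: "cj s w \<in> W" if "i \<in> J" "s \<in> S i" "w \<in> W" for i s w
    using invar_cj[OF iW(1) JI _ that(3)] S_R JI that(1,2) by blast
  interpret W: group "G\<lparr>carrier := W\<rparr>" using subgroup_imp_group[OF WG] .
  interpret W: comm_group "G\<lparr>carrier := W\<rparr>"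
    by (rule W.group_comm_groupI) (simp add: V_comm)
  interpret A: commuting_automorphisms "G\<lparr>carrier := W\<rparr>" J "\<lambda>i. cj ` S i" "\<lambda>i. cj (c i)"
  proof unfold_locales
    show "finite (carrier (G\<lparr>carrier := W\<rparr>))"
      using fin subgroup.subset[OF WG] finite_subset by auto
    show "finite J" using fin_I by (simp add: J_def)
    show "carrier (G\<lparr>carrier := W\<rparr>) \<noteq> {\<one>\<^bsub>G\<lparr>carrier := W\<rparr>\<^esub>}" using iW(2) by simp
    fix j assume j: "j \<in> J"
    note jI = JI[OF j]
    show "cj (c j) \<in> cj ` S j" using c(1)[OF j] by blast
    show "\<exists>v\<in>carrier (G\<lparr>carrier := W\<rparr>). cj (c j) v \<noteq> v" using c(2)[OF j] by simp
    fix s assume "s \<in> cj ` S j"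
    then obtain g where g: "g \<in> S j" "s = cj g" by blast
    show "s \<in> hom (G\<lparr>carrier := W\<rparr>) (G\<lparr>carrier := W\<rparr>)"
      using g SW[OF j g(1)] S_carrier[OF jI g(1)] by (intro homI) (simp_all add: cj_mult)
    {
      fix v assume v: "v \<in> carrier (G\<lparr>carrier := W\<rparr>)"
      show "s v = \<one>\<^bsub>G\<lparr>carrier := W\<rparr>\<^esub> \<Longrightarrow> v = \<one>\<^bsub>G\<lparr>carrier := W\<rparr>\<^esub>"
        using g v S_carrier[OF jI g(1)] by (simp add: cj_eq_one_iff)
      show "s (cj (c j) v) = cj (c j) (s v)" using c(3)[OF j g(1)] v g(2) by simp
      fix i t assume i: "i \<in> J" "j \<noteq> i" and "t \<in> cj ` S i"
      then obtain h where h: "h \<in> S i" "t = cj h" by blast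
      show "s (t v) = t (s v)"
        using R_comm[OF jI JI[OF i(1)] i(2), of g h v] S_R[OF jI] S_R[OF JI[OF i(1)]] g h v by auto
    }
  next
    fix i j assume ij: "i \<in> J" "j \<in> J" "i \<noteq> j"
    note iI = JI[OF ij(1)] and jI = JI[OF ij(2)]
    \<comment> \<open>If both acted alike, the powers of \<open>c i\<close> with exponents
      \<open>p i ^ k i\<close> and \<open>p j ^ k j\<close> would act trivially; by coprimality so
      would \<open>c i\<close>.\<close>
    show "\<exists>v\<in>carrier (G\<lparr>carrier := W\<rparr>). cj (c i) v \<noteq> cj (c j) v"
    proof (rule ccontr)
      assume "\<not> ?thesis"
      then have eq: "cj (c i) w = cj (c j) w" if "w \<in> W" for w using that by simp
      have [simp]: "c i \<in> carrier G" "c j \<in> carrier G"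
        using c(1) ij S_carrier iI jI by blast+
      have pow: "cj (c i [^] n) w = cj (c j [^] n) w \<and> cj (c j [^] n) w \<in> W" if "w \<in> W" for n :: nat and w
        using that
      proof (induction n arbitrary: w)
        case (Suc n)
        have w: "cj (c j) w \<in> W" using SW[OF ij(2) c(1)[OF ij(2)] Suc.prems] .
        have "cj (c i [^] Suc n) w = cj (c i [^] n) (cj (c i) w)"
          using Suc.prems by (simp add: cj_cj)
        also have "\<dots> = cj (c j [^] n) (cj (c j) w)" using Suc.IH[OF w] eq[OF Suc.prems] by simp
        also have "\<dots> = cj (c j [^] Suc n) w" using Suc.prems by (simp add: cj_cj)
        finally show ?case using Suc.IH[OF w] Suc.prems by (simp add: cj_cj)
      qed simp
      let ?K = "{g \<in> carrier G. \<forall>w\<in>W. cj g w = w}"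
      have KG: "subgroup ?K G"
      proof (rule subgroupI)
        fix g assume g: "g \<in> ?K"
        have "cj (inv g) w = w" if "w \<in> W" for w
          using cj_cancel(1)[of g w] g that by (simp del: cj_cancel)
        then show "inv g \<in> ?K" using g by simp
        fix h assume "h \<in> ?K"
        then show "g \<otimes> h \<in> ?K" using g by (auto simp: cj_cj[symmetric])
      qed (auto intro: exI[of _ \<one>])
      have "c i \<in> carrier G" by simp
      moreover have "c i [^] (p i ^ k i) \<in> ?K"
        using subgroup_pow_card[OF S_subgroup[OF iI] c(1)[OF ij(1)]] S_card[OF iI] by simp
      moreover have "c i [^] (p j ^ k j) \<in> ?K"
        using subgroup_pow_card[OF S_subgroup[OF jI] c(1)[OF ij(2)]] S_card[OF jI] pow[of _ "p j ^ k j"]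
        by simp
      ultimately have "c i \<in> ?K"
        by (rule subgroup_coprime_powers[OF KG _ _ _ coprime_p[OF iI jI ij(3)]])
      then show False using c(2)[OF ij(1)] by blast
    qed
  next
    fix U assume U: "subgroup U (G\<lparr>carrier := W\<rparr>)" "\<And>j s u. \<lbrakk>j \<in> J; s \<in> cj ` S j; u \<in> U\<rbrakk> \<Longrightarrow> s u \<in> U"
    have UW: "U \<subseteq> W" using subgroup.subset[OF U(1)] by simp
    have "subgroup U G" using incl_subgroup[OF WG U(1)] .
    \<comment> \<open>Each \<open>R i\<close> acts through \<open>S i\<close>, and indices outside
      \<open>J\<close> act trivially on \<open>W\<close>, so invariance under \<open>S j\<close> for
      \<open>j\<close> in \<open>J\<close> is enough.\<close>
    moreover have "cj r u \<in> U" if i: "i \<in> I" "r \<in> R i" "u \<in> U" for i r u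
    proof -
      have uW: "u \<in> W" using i(3) UW by blast
      obtain s where s: "s \<in> S i" "cj r u = cj s u"
        using R_acts_as_S[OF i(1,2)] invar_V[OF iW(1) uW] by blast
      show ?thesis
      proof (cases "i \<in> J")
        case True then show ?thesis using U(2)[OF True imageI[OF s(1)] i(3)] s(2) by simp
      next
        case False
        then have "cj s u = u" using s(1) i(1) uW unfolding J_def by blast
        then show ?thesis using s(2) i(3) by simp
      qed
    qed
    moreover have "U \<subseteq> V" using UW by auto
    ultimately have "invar U" by (simp add: invar_def)
    then show "U = {\<one>\<^bsub>G\<lparr>carrier := W\<rparr>\<^esub>} \<or> U = carrier (G\<lparr>carrier := W\<rparr>)"
      using W UW by (simp add: min_invar_def)
  qed
  obtain f where f: "f \<in> W" "\<And>j s. \<lbrakk>j \<in> J; s \<in> S j; cj s (f \<otimes> y j) = f \<otimes> y j\<rbrakk> \<Longrightarrow> cj s (z j) = z j"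
    using A.ex_common_translate[of z y] zy JI by auto
  have "cj s (z i) = z i" if "i \<in> I" "s \<in> S i" "cj s (f \<otimes> y i) = f \<otimes> y i" for i s
    using f(2)[OF _ that(2,3)] that zy by (cases "i \<in> J") (auto simp: J_def)
  then show "\<exists>f\<in>W. \<forall>i\<in>I. \<forall>s\<in>S i. cj s (f \<otimes> y i) = f \<otimes> y i \<longrightarrow> cj s (z i) = z i"
    using f(1) by blast
qed

lemma invar_mult:
  assumes Y: "invar Y" and W: "invar W"
  shows "invar {x \<otimes> w | x w. x \<in> Y \<and> w \<in> W}" (is "invar ?M")
proof -
  note [simp] = invar_V[OF Y] invar_V[OF W]
  note XG = invar_subgroup[OF Y] and WG = invar_subgroup[OF W] and VG = V_subgroup
  have mult: "(x \<otimes> w) \<otimes> (x' \<otimes> w') = (x \<otimes> x') \<otimes> (w \<otimes> w')"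
    if "x \<in> V" "w \<in> V" "x' \<in> V" "w' \<in> V" for x w x' w'
  proof -
    have "(x \<otimes> w) \<otimes> (x' \<otimes> w') = x \<otimes> (w \<otimes> x') \<otimes> w'" using that by (simp add: m_assoc)
    also have "\<dots> = x \<otimes> (x' \<otimes> w) \<otimes> w'" using V_comm[OF that(2,3)] by simp
    finally show ?thesis using that by (simp add: m_assoc)
  qed
  have "subgroup ?M G"
  proof (rule subgroupI)
    show "?M \<subseteq> carrier G" by auto
    show "?M \<noteq> {}" using subgroup.one_closed[OF XG] subgroup.one_closed[OF WG] by blast
    fix a assume "a \<in> ?M"
    then obtain x w where a: "x \<in> Y" "w \<in> W" "a = x \<otimes> w" by blast
    have "inv a = inv x \<otimes> inv w"
      using a V_comm[of "inv w" "inv x"] subgroup.m_inv_closed[OF VG] by (simp add: inv_mult_group)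
    then show "inv a \<in> ?M" using a subgroup.m_inv_closed[OF XG] subgroup.m_inv_closed[OF WG] by blast
    fix b assume "b \<in> ?M"
    then obtain x' w' where b: "x' \<in> Y" "w' \<in> W" "b = x' \<otimes> w'" by blast
    have "a \<otimes> b = (x \<otimes> x') \<otimes> (w \<otimes> w')" using a b mult by simp
    then show "a \<otimes> b \<in> ?M" using a b subgroup.m_closed[OF XG] subgroup.m_closed[OF WG] by blast
  qed
  moreover have "?M \<subseteq> V" using subgroup.m_closed[OF VG] by auto
  moreover have "cj r (x \<otimes> w) \<in> ?M" if "i \<in> I" "r \<in> R i" "x \<in> Y" "w \<in> W" for i r x w
  proof -
    have "cj r (x \<otimes> w) = cj r x \<otimes> cj r w" using that R_carrier by (simp add: cj_mult)
    then show ?thesis using that invar_cj[OF Y] invar_cj[OF W] by blast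
  qed
  ultimately show ?thesis unfolding invar_def by blast
qed

text \<open>In a direct product of invariant subgroups an element is fixed by \<open>s\<close>
  exactly when both components are, so the translates of the factors can be chosen independently and
  multiplied.\<close>

lemma translatable_mult:
  assumes Y: "invar Y" "translatable Y" and W: "invar W" "translatable W" and XW: "Y \<inter> W = {\<one>}"
  shows "translatable {x \<otimes> w | x w. x \<in> Y \<and> w \<in> W}" (is "translatable ?M")
  unfolding translatable_def
proof (intro allI impI)
  fix z y assume zy: "\<forall>i\<in>I. z i \<in> ?M \<and> y i \<in> ?M"
  note [simp] = invar_V[OF Y(1)] invar_V[OF W(1)]
  note XG = invar_subgroup[OF Y(1)] and WG = invar_subgroup[OF W(1)]
  have unique: "x = x' \<and> w = w'"
    if "x \<in> Y" "w \<in> W" "x' \<in> Y" "w' \<in> W" "x \<otimes> w = x' \<otimes> w'" for x w x' w'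
  proof -
    have "inv x' \<otimes> x = inv x' \<otimes> (x \<otimes> w) \<otimes> inv w" using that(1-3) by (simp add: m_assoc)
    also have "\<dots> = inv x' \<otimes> (x' \<otimes> w') \<otimes> inv w" using that by simp
    also have "\<dots> = w' \<otimes> inv w" using that(2-4) by (simp add: m_assoc[symmetric])
    finally have eq: "inv x' \<otimes> x = w' \<otimes> inv w" .
    moreover have "inv x' \<otimes> x \<in> Y" "w' \<otimes> inv w \<in> W"
      using that XG WG by (auto simp: subgroup.m_closed subgroup.m_inv_closed)
    ultimately have "inv x' \<otimes> x = \<one>" "w' \<otimes> inv w = \<one>" using XW by auto
    then show ?thesis using that mult_inv_eq_one_iff[of w' w] inv_equality[of "inv x'" x] by auto
  qed
  have "\<forall>i\<in>I. \<exists>zx zw yx yw. zx \<in> Y \<and> zw \<in> W \<and> yx \<in> Y \<and> yw \<in> W \<and>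
      z i = zx \<otimes> zw \<and> y i = yx \<otimes> yw" using zy by blast
  then obtain zx zw yx yw where d: "\<And>i. i \<in> I \<Longrightarrow> zx i \<in> Y \<and> zw i \<in> W \<and> yx i \<in> Y \<and> yw i \<in> W \<and>
      z i = zx i \<otimes> zw i \<and> y i = yx i \<otimes> yw i" by metis
  obtain f where f: "f \<in> Y" "\<And>i s. \<lbrakk>i \<in> I; s \<in> S i; cj s (f \<otimes> yx i) = f \<otimes> yx i\<rbrakk> \<Longrightarrow> cj s (zx i) = zx i"
    using translatableD[OF Y(2), of zx yx] d by blast
  obtain g where g: "g \<in> W" "\<And>i s. \<lbrakk>i \<in> I; s \<in> S i; cj s (g \<otimes> yw i) = g \<otimes> yw i\<rbrakk> \<Longrightarrow> cj s (zw i) = zw i"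
    using translatableD[OF W(2), of zw yw] d by blast
  have "cj s (z i) = z i" if i: "i \<in> I" and s: "s \<in> S i" and fx: "cj s (f \<otimes> g \<otimes> y i) = f \<otimes> g \<otimes> y i" for i s
  proof -
    have sR: "s \<in> R i" using s S_R[OF i] by blast
    have [simp]: "s \<in> carrier G" using S_carrier[OF i s] .
    note di = d[OF i]
    have XX: "f \<otimes> yx i \<in> Y" and WW: "g \<otimes> yw i \<in> W"
      using f(1) g(1) di subgroup.m_closed[OF XG] subgroup.m_closed[OF WG] by blast+
    have "f \<otimes> g \<otimes> y i = f \<otimes> (g \<otimes> yx i) \<otimes> yw i" using f(1) g(1) di by (simp add: m_assoc)
    also have "\<dots> = (f \<otimes> yx i) \<otimes> (g \<otimes> yw i)"
      using V_comm[of g "yx i"] f(1) g(1) di by (simp add: m_assoc)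
    finally have e: "f \<otimes> g \<otimes> y i = (f \<otimes> yx i) \<otimes> (g \<otimes> yw i)" .
    then have "cj s (f \<otimes> yx i) \<otimes> cj s (g \<otimes> yw i) = (f \<otimes> yx i) \<otimes> (g \<otimes> yw i)"
      using fx XX WW by (simp add: cj_mult)
    then have "cj s (f \<otimes> yx i) = f \<otimes> yx i \<and> cj s (g \<otimes> yw i) = g \<otimes> yw i"
      by (rule unique[OF invar_cj[OF Y(1) i sR XX] invar_cj[OF W(1) i sR WW] XX WW])
    then have "cj s (zx i) = zx i" "cj s (zw i) = zw i" using f(2)[OF i s] g(2)[OF i s] by blast+
    then show ?thesis using di by (simp add: cj_mult)
  qed
  moreover have "f \<otimes> g \<in> ?M" using f(1) g(1) by blast
  ultimately show "\<exists>f\<in>?M. \<forall>i\<in>I. \<forall>s\<in>S i. cj s (f \<otimes> y i) = f \<otimes> y i \<longrightarrow> cj s (z i) = z i"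
    by blast
qed

lemma ex_min_invar: "\<exists>W. min_invar W"
proof -
  let ?A = "{U. invar U \<and> U \<noteq> {\<one>}}"
  have "invar V" using V_subgroup normal_cj[OF V_normal] R_carrier by (auto simp: invar_def)
  then have "V \<in> ?A" using V_nontriv by simp
  moreover have "?A \<subseteq> Pow (carrier G)" by (auto dest: invar_V)
  then have "finite ?A" using fin by (meson finite_Pow_iff finite_subset)
  ultimately obtain W where W: "W \<in> ?A" "\<And>U. U \<in> ?A \<Longrightarrow> U \<subseteq> W \<Longrightarrow> U = W"
    by (metis (no_types, lifting) empty_iff finite_has_minimal)
  then have "min_invar W" unfolding min_invar_def by blast
  then show ?thesis by blast
qed

lemma invar_cj_image:
  assumes U: "invar U" and g: "g \<in> carrier G"
  shows "invar (cj g ` U)"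
proof -
  note [simp] = invar_V[OF U]
  have "cj g \<in> hom G G" using g by (intro homI) (simp_all add: cj_mult)
  interpret h: group_hom G G "cj g" by unfold_locales fact
  have "subgroup (cj g ` U) G" using h.subgroup_img_is_subgroup[OF invar_subgroup[OF U]] .
  moreover have "cj g ` U \<subseteq> V" using normal_cj[OF V_normal g] by auto
  moreover have "cj r (cj g u) \<in> cj g ` U" if i: "i \<in> I" "r \<in> R i" "u \<in> U" for i r u
  proof -
    let ?r = "cj (inv g) r"
    have r: "?r \<in> R i" using normal_cj[OF R_normal[OF i(1)] _ i(2)] g by simp
    have "r \<otimes> g = g \<otimes> ?r" using g R_carrier[OF i(1,2)] by (simp add: cj_def m_assoc[symmetric])
    then have "cj r (cj g u) = cj g (cj ?r u)"
      using g R_carrier[OF i(1,2)] R_carrier[OF i(1) r] i(3) by (simp add: cj_cj)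
    then show ?thesis using invar_cj[OF U i(1) r i(3)] by blast
  qed
  ultimately show ?thesis unfolding invar_def by blast
qed

lemma min_invar_cj_image:
  assumes W: "min_invar W" and g: "g \<in> carrier G"
  shows "min_invar (cj g ` W)"
proof -
  have iW: "invar W" "W \<noteq> {\<one>}" using W by (auto simp: min_invar_def)
  note [simp] = V_carrier[OF invar_V[OF iW(1)]]
  have cj_cj_image: "cj (inv g) ` cj g ` U = U" "cj g ` cj (inv g) ` U = U" if "U \<subseteq> carrier G" for U
    using that g by (force simp: image_image image_iff)+
  have WG: "W \<subseteq> carrier G" by auto
  have "cj g ` W \<noteq> {\<one>}" using cj_cj_image(1)[OF WG] iW(2) g by auto
  moreover have "U = {\<one>} \<or> U = cj g ` W" if U: "invar U" "U \<subseteq> cj g ` W" for U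
  proof -
    have UG: "U \<subseteq> carrier G" using invar_V[OF U(1)] by auto
    have "cj (inv g) ` U \<subseteq> W" using U(2) cj_cj_image(1)[OF WG] by blast
    moreover have "invar (cj (inv g) ` U)" using invar_cj_image[OF U(1)] g by simp
    ultimately have "cj (inv g) ` U = {\<one>} \<or> cj (inv g) ` U = W"
      using W unfolding min_invar_def by blast
    then show ?thesis using cj_cj_image(2)[OF UG] g by auto
  qed
  ultimately show ?thesis using invar_cj_image[OF iW(1) g] unfolding min_invar_def by blast
qed

text \<open>A maximal translatable invariant \<open>Y\<close> absorbs every conjugate of a minimal
  invariant \<open>W\<close>: a conjugate outside \<open>Y\<close> meets it trivially and would
  enlarge it.\<close>

theorem translatable_V: "translatable V"
proof -
  let ?A = "{Y. invar Y \<and> translatable Y}"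
  have "invar {\<one>}" using subgroup.one_closed[OF V_subgroup] R_carrier triv_subgroup
    by (auto simp: invar_def)
  moreover have "translatable {\<one>}" using S_carrier by (auto simp: translatable_def)
  ultimately have "{\<one>} \<in> ?A" by simp
  moreover have "?A \<subseteq> Pow (carrier G)" by (auto dest: invar_V)
  then have "finite ?A" using fin by (meson finite_Pow_iff finite_subset)
  ultimately obtain Y where Y: "Y \<in> ?A" "\<And>Z. Z \<in> ?A \<Longrightarrow> Y \<subseteq> Z \<Longrightarrow> Z = Y"
    by (metis (no_types, lifting) empty_iff finite_has_maximal)
  have iX: "invar Y" "translatable Y" using Y(1) by auto
  note XG = invar_subgroup[OF iX(1)]
  obtain W where W: "min_invar W" using ex_min_invar by blast
  have WX: "cj g ` W \<subseteq> Y" if g: "g \<in> carrier G" for g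
  proof (rule ccontr)
    let ?W = "cj g ` W"
    assume nW: "\<not> ?W \<subseteq> Y"
    have W': "min_invar ?W" using min_invar_cj_image[OF W g] .
    then have iW: "invar ?W" by (simp add: min_invar_def)
    have "invar (Y \<inter> ?W)" using invar_Int[OF iX(1) iW] .
    then have XW: "Y \<inter> ?W = {\<one>}" using W' nW unfolding min_invar_def by blast
    let ?M = "{x \<otimes> w | x w. x \<in> Y \<and> w \<in> ?W}"
    have "?M \<in> ?A"
      using invar_mult[OF iX(1) iW]
        translatable_mult[OF iX iW min_invar_translatable[OF W'] XW] by blast
    moreover have "Y \<subseteq> ?M"
    proof
      fix x assume "x \<in> Y"
      then have "x = x \<otimes> \<one>" "x \<in> Y" using invar_V[OF iX(1)] by auto
      then show "x \<in> ?M" using XW by blast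
    qed
    ultimately have "?M = Y" by (rule Y(2))
    moreover have "?W \<subseteq> ?M"
    proof
      fix w assume "w \<in> ?W"
      then have "w = \<one> \<otimes> w" "w \<in> ?W" using invar_V[OF iW] by auto
      then show "w \<in> ?M" using XW by blast
    qed
    ultimately show False using nW by simp
  qed
  \<comment> \<open>The largest subgroup of \<open>Y\<close> normal in the whole group. It contains
    \<open>W\<close>, so minimality of \<open>V\<close> gives \<open>?N = V\<close>.\<close>
  let ?N = "{v \<in> Y. \<forall>g\<in>carrier G. cj g v \<in> Y}"
  note [simp] = V_carrier[OF invar_V[OF iX(1)]]
  have "?N \<lhd> G"
  proof (rule normalI_cj)
    show "subgroup ?N G"
      using subgroup.one_closed[OF XG] subgroup.m_closed[OF XG] subgroup.m_inv_closed[OF XG]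
      by (intro subgroupI) (auto simp: cj_mult cj_inv)
    show "cj g x \<in> ?N" if "g \<in> carrier G" "x \<in> ?N" for g x
      using that by (auto simp: cj_cj)
  qed
  moreover have "?N \<subseteq> V" using invar_V[OF iX(1)] by auto
  moreover have iW: "invar W" "W \<noteq> {\<one>}" using W by (auto simp: min_invar_def)
  have "W \<subseteq> ?N"
  proof
    fix w assume w: "w \<in> W"
    then have "cj \<one> w \<in> Y" using WX[of \<one>] by blast
    then show "w \<in> ?N" using WX w invar_V[OF iW(1) w] by auto
  qed
  then have "?N \<noteq> {\<one>}" using iW subgroup.one_closed[OF invar_subgroup[OF iW(1)]] by blast
  ultimately have "?N = V" using V_minimal by blast
  then have "Y = V" using invar_V[OF iX(1)] by blast
  then show ?thesis using iX(2) by simp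
qed

end

subsection \<open>Sylow subgroups and cores\<close>

text \<open>The normal core. For a Sylow subgroup of a finite group it is \<open>p_core\<close>, by
  conjugacy.\<close>

definition (in group) core :: "'a set \<Rightarrow> 'a set" where
  "core Q = {a \<in> carrier G. \<forall>h\<in>carrier G. cj h a \<in> Q}"

text \<open>Since \<open>cj x a \<in> Q\<close> means \<open>a \<in> Q\<^sup>x\<close>, this says \<open>Q i \<inter> Q i\<^sup>x = core (Q i)\<close> for all \<open>i\<close>.\<close>

definition (in group) core_conjugator :: "'i set \<Rightarrow> ('i \<Rightarrow> 'a set) \<Rightarrow> 'a \<Rightarrow> bool" where
  "core_conjugator I Q x \<longleftrightarrow> x \<in> carrier G \<and> (\<forall>i\<in>I. \<forall>a\<in>Q i. cj x a \<in> Q i \<longrightarrow> a \<in> core (Q i))"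

context group
begin

lemma core_conjugator_cong:
  "(\<And>i. i \<in> I \<Longrightarrow> Q i = Q' i) \<Longrightarrow> core_conjugator I Q = core_conjugator I Q'"
  by (simp add: core_conjugator_def fun_eq_iff)

lemma core_subset: "core Q \<subseteq> Q"
  unfolding core_def by (auto dest: bspec[of _ _ \<one>])

lemma cj_core: "\<lbrakk>h \<in> carrier G; a \<in> core Q\<rbrakk> \<Longrightarrow> cj h a \<in> core Q"
  by (simp add: core_def cj_cj)

lemma cj_core_iff: "\<lbrakk>h \<in> carrier G; a \<in> carrier G\<rbrakk> \<Longrightarrow> cj h a \<in> core Q \<longleftrightarrow> a \<in> core Q"
  using cj_core[of "inv h" "cj h a" Q] cj_core[of h a Q] by auto

lemma core_normal:
  assumes "subgroup Q G"
  shows "core Q \<lhd> G"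
proof (rule normalI_cj)
  note Q = subgroup.one_closed[OF assms] subgroup.m_closed[OF assms] subgroup.m_inv_closed[OF assms]
  show "subgroup (core Q) G"
    by (rule subgroupI) (auto simp: core_def cj_mult cj_inv Q intro!: exI[of _ \<one>])
qed (rule cj_core)

lemma normal_subset_core: "\<lbrakk>N \<lhd> G; N \<subseteq> Q\<rbrakk> \<Longrightarrow> N \<subseteq> core Q"
  using normal_cj normal_imp_subgroup subgroup.mem_carrier unfolding core_def by fast

lemma cj_image_subgroup:
  assumes "subgroup Q G" "g \<in> carrier G"
  shows "subgroup (cj g ` Q) G"
proof -
  have "cj g \<in> hom G G" using assms by (intro homI) (simp_all add: cj_mult)
  then interpret h: group_hom G G "cj g" by unfold_locales
  show ?thesis by (rule h.subgroup_img_is_subgroup[OF assms(1)])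
qed

lemma inj_on_cj: "g \<in> carrier G \<Longrightarrow> inj_on (cj g) (carrier G)"
  by (rule inj_on_inverseI[of _ "cj (inv g)"]) simp

lemma card_cj_image: "\<lbrakk>subgroup Q G; g \<in> carrier G\<rbrakk> \<Longrightarrow> card (cj g ` Q) = card Q"
  using inj_on_cj subgroup.subset by (metis card_image inj_on_subset)

lemma subgroup_set_mult_normal: "\<lbrakk>subgroup P G; N \<lhd> G\<rbrakk> \<Longrightarrow> subgroup (P <#> N) G"
  using mult_norm_subgroup commut_normal by metis

lemma card_complement:
  assumes S: "subgroup S G" and V: "subgroup V G" and "S \<inter> V = {\<one>}"
  shows "card (S <#> V) = card S * card V"
proof -
  have "inj_on (\<lambda>(s, v). s \<otimes> v) (S \<times> V)"
  proof (rule inj_onI, clarify)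
    fix s v s' v'
    assume sv: "s \<in> S" "v \<in> V" "s' \<in> S" "v' \<in> V" and eq: "s \<otimes> v = s' \<otimes> v'"
    note [simp] = subgroup.mem_carrier[OF S] subgroup.mem_carrier[OF V]
    have "inv s' \<otimes> s = inv s' \<otimes> (s \<otimes> v) \<otimes> inv v" using sv by (simp add: m_assoc)
    also have "\<dots> = inv s' \<otimes> (s' \<otimes> v') \<otimes> inv v" using eq by simp
    also have "\<dots> = v' \<otimes> inv v" using sv by (simp add: m_assoc[symmetric])
    finally have "inv s' \<otimes> s = v' \<otimes> inv v" .
    moreover have "inv s' \<otimes> s \<in> S" "v' \<otimes> inv v \<in> V"
      using sv S V by (auto simp: subgroup.m_closed subgroup.m_inv_closed)
    ultimately have "inv s' \<otimes> s = \<one>" "v' \<otimes> inv v = \<one>" using assms(3) by auto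
    then show "s = s' \<and> v = v'"
      using sv mult_inv_eq_one_iff[of v' v] inv_equality[of "inv s'" s] by auto
  qed
  moreover have "S <#> V = (\<lambda>(s, v). s \<otimes> v) ` (S \<times> V)" by (auto simp: set_mult_def)
  ultimately show ?thesis by (simp add: card_image card_cartesian_product)
qed

lemma ex_element_of_prime_order:
  assumes fin: "finite (carrier G)" and V: "subgroup V G"
    and p: "Factorial_Ring.prime (p::nat)" "p dvd card V"
  shows "\<exists>v\<in>V. v \<noteq> \<one> \<and> v [^] p = \<one>"
proof -
  interpret V: group "G\<lparr>carrier := V\<rparr>" using subgroup_imp_group[OF V] .
  have "finite V" using fin subgroup.subset[OF V] finite_subset by blast
  moreover obtain m where "card V = p * m" using p(2) by blast
  ultimately obtain H where H: "subgroup H (G\<lparr>carrier := V\<rparr>)" "card H = p"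
    using sylow_thm[OF p(1) V.group_axioms, of 1 m] by (auto simp: order_def)
  have HG: "subgroup H G" by (rule incl_subgroup[OF V H(1)])
  have "H \<noteq> {\<one>}" using H(2) p(1) by auto
  moreover have "\<one> \<in> H" using HG subgroup.one_closed by blast
  ultimately obtain v where "v \<in> H" "v \<noteq> \<one>" by blast
  then show ?thesis using subgroup_pow_card[OF HG] H(2) subgroup.subset[OF H(1)] by auto
qed

text \<open>The elements of \<open>V\<close> killed by \<open>p\<close> form a nontrivial normal
  subgroup, hence all of \<open>V\<close>. So \<open>V\<close> is a \<open>p\<close>-group, some
  conjugate of it lies in \<open>P\<close>, and normality removes the conjugation.\<close>

lemma minimal_normal_le_sylow:
  assumes fin: "finite (carrier G)"
    and V: "V \<lhd> G" "\<And>v w. \<lbrakk>v \<in> V; w \<in> V\<rbrakk> \<Longrightarrow> v \<otimes> w = w \<otimes> v"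
    and V_minimal: "\<And>N. \<lbrakk>N \<lhd> G; N \<subseteq> V\<rbrakk> \<Longrightarrow> N = {\<one>} \<or> N = V"
    and p: "Factorial_Ring.prime (p::nat)" "p dvd card V"
    and P: "subgroup P G" "\<not> p dvd order G div card P"
  shows "V \<subseteq> P"
proof -
  interpret V: normal V G by fact
  let ?N = "{v \<in> V. v [^] p = \<one>}"
  have "?N \<lhd> G"
  proof (rule normalI_cj)
    show "subgroup ?N G"
    proof (rule subgroupI)
      show "?N \<noteq> {}" by (auto intro: exI[of _ \<one>])
      fix a assume a: "a \<in> ?N"
      then show "inv a \<in> ?N" by (simp add: nat_pow_inv)
      fix b assume b: "b \<in> ?N"
      have "(a \<otimes> b) [^] p = a [^] p \<otimes> b [^] p"
        using a b V(2)[of a b] by (intro pow_mult_distrib) auto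
      then show "a \<otimes> b \<in> ?N" using a b by simp
    qed auto
    fix g x assume g: "g \<in> carrier G" and x: "x \<in> ?N"
    have "cj g x [^] n = cj g (x [^] n)" for n :: nat
      using g x by (induction n) (simp_all add: cj_mult)
    then show "cj g x \<in> ?N" using g x normal_cj[OF V(1) g] by simp
  qed
  moreover have "?N \<noteq> {\<one>}"
    using ex_element_of_prime_order[OF fin V.subgroup_axioms p] by blast
  ultimately have "?N = V" using V_minimal[of ?N] by blast
  then have Vp: "v [^] p = \<one>" if "v \<in> V" for v using that by blast
  have finV: "finite V" using fin V.subset finite_subset by blast
  then have "card V \<noteq> 0" using V.one_closed by (metis card_0_eq empty_iff)
  \<comment> \<open>Cauchy's theorem excludes any other prime divisor, so \<open>card V\<close> is a
    power of \<open>p\<close>.\<close>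
  have "q = p" if q: "Factorial_Ring.prime q" "q dvd card V" for q :: nat
  proof (rule ccontr)
    assume "q \<noteq> p"
    obtain v where v: "v \<in> V" "v \<noteq> \<one>" "v [^] q = \<one>"
      using ex_element_of_prime_order[OF fin V.subgroup_axioms q] by blast
    have "coprime q p" using q(1) p(1) \<open>q \<noteq> p\<close> primes_coprime by blast
    then have "v \<in> {\<one>}"
      using subgroup_coprime_powers[OF triv_subgroup, of v q p] v Vp[OF v(1)] by simp
    then show False using v by simp
  qed
  moreover obtain m where m: "card V = p ^ multiplicity p (card V) * m" "\<not> p dvd m"
    using multiplicity_decompose'[OF \<open>card V \<noteq> 0\<close>] p(1) not_prime_unit by metis
  ultimately have "m = 1" using prime_factor_nat[of m] by (metis dvd_triv_right dvd_trans)
  then have "card V = p ^ multiplicity p (card V)" using m(1) by simp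
  then obtain g where g: "g \<in> carrier G" "\<forall>x\<in>V. g \<otimes> x \<otimes> inv g \<in> P"
    using p_subgroup_conj_into[OF p(1) fin V.subgroup_axioms _ P] by blast
  show ?thesis
  proof
    fix v assume v: "v \<in> V"
    then have "cj (inv g) v \<in> V" using normal_cj[OF V(1)] g(1) by blast
    then have "cj g (cj (inv g) v) \<in> P" using g(2) by (simp add: cj_def)
    then show "v \<in> P" using g(1) v by simp
  qed
qed

section \<open>Lifting through an abelian minimal normal subgroup\<close>

text \<open>Dedekind's law splits \<open>R\<close> into \<open>P \<inter> R\<close> and
  \<open>V\<close>, which meet trivially by coprimality. The last claim is a Frattini argument:
  conjugates of \<open>P \<inter> R\<close> stay in the normal subgroup \<open>R\<close> and can be
  conjugated back inside it.\<close>

lemma core_sylow_decomposition: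
  assumes fin: "finite (carrier G)" and V: "V \<lhd> G"
    and p: "Factorial_Ring.prime (p::nat)" "\<not> p dvd card V"
    and P: "subgroup P G" "card P = p ^ k"
  defines "R \<equiv> core (P <#> V)"
  shows "R \<lhd> G" "V \<subseteq> R" "subgroup (P \<inter> R) G" "\<exists>l. card (P \<inter> R) = p ^ l"
    "\<And>r. r \<in> R \<Longrightarrow> \<exists>s\<in>P \<inter> R. \<exists>v\<in>V. r = s \<otimes> v"
    "P \<inter> R \<inter> V = {\<one>}"
    "\<And>x. x \<in> carrier G \<Longrightarrow> \<exists>v\<in>V. \<forall>a\<in>P \<inter> R. cj v (cj x a) \<in> P \<inter> R"
proof -
  let ?S = "P \<inter> R"
  note VG = normal_imp_subgroup[OF V]
  have PV: "subgroup (P <#> V) G" by (rule subgroup_set_mult_normal[OF P(1) V])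
  show R: "R \<lhd> G" unfolding R_def by (rule core_normal[OF PV])
  note RG = normal_imp_subgroup[OF R]
  have "V \<subseteq> P <#> V"
  proof
    fix v assume v: "v \<in> V"
    then have "v = \<one> \<otimes> v" using subgroup.mem_carrier[OF VG v] by simp
    then show "v \<in> P <#> V" using v subgroup.one_closed[OF P(1)] unfolding set_mult_def by blast
  qed
  then show VR: "V \<subseteq> R" unfolding R_def by (rule normal_subset_core[OF V])
  show S: "subgroup ?S G" by (rule subgroups_Inter_pair[OF P(1) RG])
  have cardS: "card ?S dvd card P"
  proof -
    interpret P: group "G\<lparr>carrier := P\<rparr>" using subgroup_imp_group[OF P(1)] .
    have "subgroup ?S (G\<lparr>carrier := P\<rparr>)" using S P(1) by (intro subgroup_incl) auto
    then have "card (rcosets\<^bsub>G\<lparr>carrier := P\<rparr>\<^esub> ?S) * card ?S = card P"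
      using P.lagrange by (simp add: order_def)
    then show ?thesis by (metis dvd_triv_right)
  qed
  then show "\<exists>l. card ?S = p ^ l" using P(2) p(1) divides_primepow_nat by metis
  then obtain l where l: "card ?S = p ^ l" by blast
  show decomp: "\<exists>s\<in>?S. \<exists>v\<in>V. r = s \<otimes> v" if r: "r \<in> R" for r
  proof -
    have "r \<in> P <#> V" using r core_subset unfolding R_def by blast
    then obtain s v where sv: "s \<in> P" "v \<in> V" "r = s \<otimes> v" unfolding set_mult_def by blast
    then have "s = r \<otimes> inv v"
      using subgroup.mem_carrier[OF P(1)] subgroup.mem_carrier[OF VG] by (simp add: m_assoc)
    moreover have "r \<otimes> inv v \<in> R"
      using r VR sv(2) subgroup.m_closed[OF RG] subgroup.m_inv_closed[OF RG] by blast
    ultimately show ?thesis using sv by blast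
  qed
  have "P \<inter> V = {\<one>}"
  proof -
    have "v = \<one>" if v: "v \<in> P" "v \<in> V" for v
    proof -
      have "v [^] card P = \<one>" "v [^] card V = \<one>"
        using subgroup_pow_card[OF P(1) v(1)] subgroup_pow_card[OF VG v(2)] by auto
      moreover have "coprime (card P) (card V)"
        using P(2) p prime_imp_coprime by (metis coprime_power_left_iff)
      ultimately show ?thesis
        using subgroup_coprime_powers[OF triv_subgroup, of v "card P" "card V"]
          subgroup.mem_carrier[OF VG v(2)] by simp
    qed
    then show ?thesis using subgroup.one_closed[OF P(1)] subgroup.one_closed[OF VG] by blast
  qed
  then show SV: "?S \<inter> V = {\<one>}" using VR by blast
  have "?S <#> V = R"
  proof
    show "?S <#> V \<subseteq> R" using VR subgroup.m_closed[OF RG] unfolding set_mult_def by blast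
    show "R \<subseteq> ?S <#> V" using decomp unfolding set_mult_def by blast
  qed
  then have "card R = card ?S * card V" using card_complement[OF S VG SV] by simp
  moreover have "card ?S \<noteq> 0" using l p(1) by simp
  ultimately have index: "\<not> p dvd card R div card ?S" using p(2) by simp
  fix x assume x: "x \<in> carrier G"
  have xS: "cj x ` ?S \<subseteq> R" "card (cj x ` ?S) = p ^ l"
    using normal_cj[OF R x] card_cj_image[OF S x] l by auto
  obtain r where r: "r \<in> R" "\<forall>b\<in>cj x ` ?S. cj r b \<in> ?S"
    using p_subgroup_conj_into_within[OF p(1) fin RG cj_image_subgroup[OF S x] xS S Int_lower2 index]
    unfolding cj_def by blast
  \<comment> \<open>The factor \<open>s\<close> normalizes \<open>?S\<close>, so the conjugator
    \<open>r\<close> can be replaced by its part in \<open>V\<close>.\<close>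
  obtain s v where sv: "s \<in> ?S" "v \<in> V" "r = s \<otimes> v" using decomp[OF r(1)] by blast
  have sG: "s \<in> carrier G" and vG: "v \<in> carrier G"
    using sv subgroup.mem_carrier[OF S] subgroup.mem_carrier[OF VG] by blast+
  have "cj v (cj x a) \<in> ?S" if a: "a \<in> ?S" for a
  proof -
    have aG: "a \<in> carrier G" using a subgroup.mem_carrier[OF S] by blast
    have "cj r (cj x a) \<in> ?S" using r(2) a by blast
    then have "inv s \<otimes> cj r (cj x a) \<otimes> s \<in> ?S"
      using sv(1) subgroup.m_closed[OF S] subgroup.m_inv_closed[OF S] by blast
    moreover have "inv s \<otimes> cj r (cj x a) \<otimes> s = cj (inv s) (cj r (cj x a))"
      using sG by (simp add: cj_def)
    moreover have "cj r (cj x a) = cj s (cj v (cj x a))" using sG vG x aG sv(3) by (simp add: cj_cj m_assoc)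
    ultimately show ?thesis using sG vG x aG by simp
  qed
  then show "\<exists>v\<in>V. \<forall>a\<in>?S. cj v (cj x a) \<in> ?S" using sv(2) by blast
qed

theorem lift_simultaneous_conjugator:
  fixes p k :: "'i \<Rightarrow> nat" and P :: "'i \<Rightarrow> 'a set"
  assumes fin: "finite (carrier G)"
    and V: "V \<lhd> G" "\<And>v w. \<lbrakk>v \<in> V; w \<in> V\<rbrakk> \<Longrightarrow> v \<otimes> w = w \<otimes> v" "V \<noteq> {\<one>}"
    and V_minimal: "\<And>N. \<lbrakk>N \<lhd> G; N \<subseteq> V\<rbrakk> \<Longrightarrow> N = {\<one>} \<or> N = V"
    and I: "finite I" and p: "\<And>i. i \<in> I \<Longrightarrow> Factorial_Ring.prime (p i)" "inj_on p I"
    and P: "\<And>i. i \<in> I \<Longrightarrow> subgroup (P i) G" "\<And>i. i \<in> I \<Longrightarrow> card (P i) = p i ^ k i"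
      "\<And>i. i \<in> I \<Longrightarrow> \<not> p i dvd order G div card (P i)"
    and single: "\<And>i. i \<in> I \<Longrightarrow> \<exists>g\<in>carrier G. \<forall>a\<in>P i. cj g a \<in> P i \<longrightarrow> a \<in> core (P i)"
    and quot: "\<exists>x. core_conjugator I (\<lambda>i. P i <#> V) x"
  shows "\<exists>x. core_conjugator I P x"
proof -
  note VG = normal_imp_subgroup[OF V(1)]
  note [simp] = subgroup.mem_carrier[OF VG]
  obtain x where x: "x \<in> carrier G"
    "\<And>i a. \<lbrakk>i \<in> I; a \<in> P i <#> V; cj x a \<in> P i <#> V\<rbrakk> \<Longrightarrow> a \<in> core (P i <#> V)"
    using quot unfolding core_conjugator_def by blast
  \<comment> \<open>If \<open>p i\<close> divides \<open>card V\<close>, then \<open>V\<close> lies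
    in \<open>P i\<close> and nothing has to be lifted for \<open>i\<close>.\<close>
  define I' where "I' = {i \<in> I. \<not> p i dvd card V}"
  define R where "R i = core (P i <#> V)" for i
  define S where "S i = P i \<inter> R i" for i
  have I': "i \<in> I" "\<not> p i dvd card V" if "i \<in> I'" for i using that by (auto simp: I'_def)
  have D: "R i \<lhd> G" "V \<subseteq> R i" "subgroup (S i) G" "\<exists>l. card (S i) = p i ^ l"
    "\<And>r. r \<in> R i \<Longrightarrow> \<exists>s\<in>S i. \<exists>v\<in>V. r = s \<otimes> v" "S i \<inter> V = {\<one>}"
    "\<And>x. x \<in> carrier G \<Longrightarrow> \<exists>v\<in>V. \<forall>a\<in>S i. cj v (cj x a) \<in> S i" if i: "i \<in> I'" for i
    using core_sylow_decomposition[OF fin V(1) p(1)[OF I'(1)[OF i]] I'(2)[OF i]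
        P(1)[OF I'(1)[OF i]] P(2)[OF I'(1)[OF i]]]
    unfolding S_def R_def by blast+
  have "\<exists>l. \<forall>i\<in>I'. card (S i) = p i ^ l i" using D(4) by metis
  then obtain l where l: "\<And>i. i \<in> I' \<Longrightarrow> card (S i) = p i ^ l i" by blast
  interpret C: coprime_normal_sections G V I' p l S R
  proof (intro coprime_normal_sections.intro coprime_normal_sections_axioms.intro)
    show "inj_on p I'" using p(2) by (rule inj_on_subset) (auto simp: I'_def)
    show "finite I'" using I by (simp add: I'_def)
    show "S i \<subseteq> R i" for i by (simp add: S_def)
    show "Factorial_Ring.prime (p i)" if "i \<in> I'" for i using p(1) I'(1) that by blast
  qed (fact is_group fin V V_minimal D l)+
  \<comment> \<open>The hypothesis \<open>single\<close> gives \<open>g\<close> for one prime.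
    Correcting \<open>g\<close> by \<open>u\<close> in \<open>V\<close> yields a permutation of
    \<open>S i\<close>; an \<open>s\<close> commuting with \<open>u\<close> is then
    \<open>cj g a\<close> with both \<open>a\<close> and \<open>s\<close> in \<open>P i\<close>,
    hence in the core.\<close>
  have "\<exists>u\<in>V. \<forall>s\<in>S i. cj s u = u \<longrightarrow> s \<in> core (P i)" if i: "i \<in> I'" for i
  proof -
    note iI = I'[OF i]
    note SG = D(3)[OF i]
    obtain g where g: "g \<in> carrier G" "\<And>a. \<lbrakk>a \<in> P i; cj g a \<in> P i\<rbrakk> \<Longrightarrow> a \<in> core (P i)"
      using single[OF iI(1)] by blast
    obtain u where u: "u \<in> V" "\<forall>a\<in>S i. cj u (cj g a) \<in> S i"
      using D(7)[OF i g(1)] by blast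
    have "inj_on (\<lambda>a. cj u (cj g a)) (S i)"
    proof (rule inj_onI)
      fix a b assume ab: "a \<in> S i" "b \<in> S i" "cj u (cj g a) = cj u (cj g b)"
      then have "cj g a = cj g b"
        using inj_onD[OF inj_on_cj[of u]] u(1) g(1) subgroup.mem_carrier[OF SG] by simp
      then show "a = b" using inj_onD[OF inj_on_cj[OF g(1)]] ab subgroup.mem_carrier[OF SG] by simp
    qed
    moreover have "finite (S i)" using fin subgroup.subset[OF SG] finite_subset by blast
    ultimately have surj: "(\<lambda>a. cj u (cj g a)) ` S i = S i" using u(2) by (intro endo_inj_surj) auto
    have "s \<in> core (P i)" if s: "s \<in> S i" "cj s u = u" for s
    proof -
      obtain a where a: "a \<in> S i" "s = cj u (cj g a)" using s(1) surj by blast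
      have aG: "a \<in> carrier G" and sG: "s \<in> carrier G" using a(1) s(1) subgroup.mem_carrier[OF SG] by blast+
      have "cj u s = s" using s(2) cj_fix_sym[of s u] sG u(1) by simp
      then have "cj u s = cj u (cj g a)" using a(2) by simp
      then have ga: "cj g a = s"
        using inj_onD[OF inj_on_cj[of u]] u(1) sG aG g(1) by simp
      then have "a \<in> core (P i)" using g(2)[of a] a(1) s(1) by (simp add: S_def)
      then show ?thesis using cj_core[OF g(1)] ga by blast
    qed
    then show ?thesis using u(1) by blast
  qed
  then obtain u where u: "\<And>i. i \<in> I' \<Longrightarrow> u i \<in> V"
    "\<And>i s. \<lbrakk>i \<in> I'; s \<in> S i; cj s (u i) = u i\<rbrakk> \<Longrightarrow> s \<in> core (P i)" by metis
  have "\<exists>y\<in>V. \<forall>a\<in>S i. cj y (cj x a) \<in> S i" if "i \<in> I'" for i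
    using D(7)[OF that x(1)] .
  then obtain y where y: "\<And>i. i \<in> I' \<Longrightarrow> y i \<in> V"
    "\<And>i a. \<lbrakk>i \<in> I'; a \<in> S i\<rbrakk> \<Longrightarrow> cj (y i) (cj x a) \<in> S i" by metis
  \<comment> \<open>The prescribed points are the inverses of \<open>y i\<close>, where
    \<open>y i\<close> moves the conjugate of \<open>S i\<close> by \<open>x\<close> back into
    \<open>S i\<close>; the targets are the \<open>u i\<close>. The new conjugator will be
    \<open>f \<otimes> x\<close>.\<close>
  obtain f where f: "f \<in> V"
    "\<And>i s. \<lbrakk>i \<in> I'; s \<in> S i; cj s (f \<otimes> inv (y i)) = f \<otimes> inv (y i)\<rbrakk> \<Longrightarrow> cj s (u i) = u i"
    using C.translatableD[OF C.translatable_V, of u "\<lambda>i. inv (y i)"] u(1) y(1)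
      subgroup.m_inv_closed[OF VG] by blast
  have "a \<in> core (P i)" if i: "i \<in> I" and a: "a \<in> P i" "cj (f \<otimes> x) a \<in> P i" for i a
  proof -
    have PV: "subgroup (P i <#> V) G" by (rule subgroup_set_mult_normal[OF P(1)[OF i] V(1)])
    have aG [simp]: "a \<in> carrier G" using a(1) subgroup.mem_carrier[OF P(1)[OF i]] by blast
    have fG [simp]: "f \<in> carrier G" using f(1) by simp
    have P_PV: "P i \<subseteq> P i <#> V" and V_PV: "V \<subseteq> P i <#> V"
    proof -
      have "b = b \<otimes> \<one>" if "b \<in> P i" for b using that subgroup.mem_carrier[OF P(1)[OF i]] by simp
      then show "P i \<subseteq> P i <#> V" using subgroup.one_closed[OF VG] unfolding set_mult_def by blast
      have "v = \<one> \<otimes> v" if "v \<in> V" for v using that by simp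
      then show "V \<subseteq> P i <#> V"
        using subgroup.one_closed[OF P(1)[OF i]] unfolding set_mult_def by blast
    qed
    \<comment> \<open>The two conjugates differ only by conjugation with \<open>f\<close> in
      \<open>V\<close>, so the choice of \<open>x\<close> modulo \<open>V\<close> already places
      \<open>a\<close> in \<open>R i\<close>.\<close>
    have eq: "cj x a = inv f \<otimes> cj (f \<otimes> x) a \<otimes> f"
      using x(1) by (simp add: cj_def inv_mult_group m_assoc) (simp add: m_assoc[symmetric])
    have "inv f \<otimes> cj (f \<otimes> x) a \<otimes> f \<in> P i <#> V"
      using a(2) f(1) P_PV V_PV subgroup.m_closed[OF PV] subgroup.m_inv_closed[OF PV] by blast
    then have "cj x a \<in> P i <#> V" using eq by simp
    then have aR: "a \<in> R i" using x(2)[OF i] a(1) P_PV unfolding R_def by blast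
    show ?thesis
    proof (cases "i \<in> I'")
      case True
      note iI = I'[OF True]
      note SG = D(3)[OF True]
      note RN = D(1)[OF True]
      have aS: "a \<in> S i" using a(1) aR by (simp add: S_def)
      let ?y = "y i" and ?b = "cj x a"
      let ?s = "cj ?y ?b" and ?w = "f \<otimes> inv ?y"
      have yG [simp]: "?y \<in> carrier G" using y(1)[OF True] by simp
      have sS: "?s \<in> S i" using y(2)[OF True aS] .
      have wV: "?w \<in> V"
        using f(1) y(1)[OF True] subgroup.m_closed[OF VG] subgroup.m_inv_closed[OF VG] by blast
      have ws: "cj ?w ?s = cj (f \<otimes> x) a" using x(1) by (simp add: cj_cj m_assoc) (simp add: m_assoc[symmetric])
      have "cj (f \<otimes> x) a \<in> R i" using normal_cj[OF RN _ aR, of "f \<otimes> x"] x(1) by simp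
      then have wsS: "cj ?w ?s \<in> S i" using ws a(2) by (simp add: S_def)
      have sG: "?s \<in> carrier G" using x(1) by simp
      have wG: "?w \<in> carrier G" by simp
      \<comment> \<open>This commutator lies in \<open>S i\<close>, and also in \<open>V\<close>
        because \<open>?w\<close> does; these meet trivially, so \<open>?s\<close> and
        \<open>?w\<close> commute. The choice of \<open>f\<close> then makes \<open>?s\<close> fix
        \<open>u i\<close>.\<close>
      have "cj ?w ?s \<otimes> inv ?s \<in> S i"
        using wsS sS subgroup.m_closed[OF SG] subgroup.m_inv_closed[OF SG] by blast
      moreover have "cj ?w ?s \<otimes> inv ?s = ?w \<otimes> cj ?s (inv ?w)"
        using sG wG unfolding cj_def[of ?w] cj_def[of ?s] by (simp add: m_assoc)
      then have "cj ?w ?s \<otimes> inv ?s \<in> V"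
        using wV normal_cj[OF V(1) sG] subgroup.m_closed[OF VG] subgroup.m_inv_closed[OF VG] by simp
      ultimately have "cj ?w ?s \<otimes> inv ?s = \<one>"
        using D(6)[OF True] by blast
      then have "cj ?w ?s = ?s" using mult_inv_eq_one_iff sG wG by simp
      then have "cj ?s ?w = ?w" using cj_fix_sym[OF sG wG] by simp
      then have "?s \<in> core (P i)" using f(2)[OF True sS] u(2)[OF True sS] by blast
      then show ?thesis using x(1) by (simp add: cj_core_iff)
    next
      case False
      then have "V \<subseteq> P i"
        using minimal_normal_le_sylow[OF fin V(1,2) V_minimal p(1)[OF i] _ P(1,3)[OF i]] i
        by (simp add: I'_def)
      then have "P i <#> V \<subseteq> P i"
        using subgroup.m_closed[OF P(1)[OF i]] unfolding set_mult_def by blast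
      then have "P i <#> V = P i" using P_PV by blast
      then show ?thesis using aR by (simp add: R_def)
    qed
  qed
  moreover have "f \<otimes> x \<in> carrier G" using f(1) x(1) by simp
  ultimately show ?thesis unfolding core_conjugator_def by blast
qed

section \<open>Sylow subgroups, the star property and solvability\<close>

lemma sylow_index:
  assumes fin: "finite (carrier G)" and p: "Factorial_Ring.prime p" and P: "sylow_subgroup G p P"
  shows "\<not> p dvd order G div card P"
proof -
  have nz: "order G \<noteq> 0" using fin order_gt_0_iff_finite by simp
  obtain m where "order G = p ^ multiplicity p (order G) * m" "\<not> p dvd m"
    using multiplicity_decompose'[OF nz] p not_prime_unit by metis
  then have "order G div card P = m"
    using P p prime_gt_0_nat unfolding sylow_subgroup_def
    by (metis nonzero_mult_div_cancel_left not_prime_0 power_not_zero)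
  then show ?thesis using \<open>\<not> p dvd m\<close> by simp
qed

lemma sylow_subgroupI:
  assumes fin: "finite (carrier G)" and p: "Factorial_Ring.prime p"
    and P: "subgroup P G" "card P = p ^ k" "\<not> p dvd order G div card P"
  shows "sylow_subgroup G p P"
proof -
  have "card P dvd order G" using lagrange[OF P(1)] by (metis dvd_triv_right)
  then obtain m where m: "order G = card P * m" by blast
  have "order G \<noteq> 0" using fin order_gt_0_iff_finite by simp
  then have "card P \<noteq> 0" "m \<noteq> 0" using m by auto
  then have "\<not> p dvd m" using P(3) m by simp
  then have "multiplicity p (order G) = k"
    using m P(2) p \<open>m \<noteq> 0\<close> by (simp add: prime_elem_multiplicity_mult_distrib not_dvd_imp_multiplicity_0)
  then show ?thesis using P(1,2) by (simp add: sylow_subgroup_def)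
qed

lemma sylow_conj_image:
  assumes "sylow_subgroup G p P" "g \<in> carrier G"
  shows "sylow_subgroup G p (cj g ` P)"
  using assms cj_image_subgroup card_cj_image by (simp add: sylow_subgroup_def)

lemma sylow_conjugate:
  assumes fin: "finite (carrier G)" and p: "Factorial_Ring.prime p"
    and P: "sylow_subgroup G p P" and Q: "sylow_subgroup G p Q"
  shows "\<exists>g\<in>carrier G. cj g ` P = Q"
proof -
  have PG: "subgroup P G" and QG: "subgroup Q G"
    and cP: "card P = p ^ multiplicity p (order G)" and cQ: "card Q = p ^ multiplicity p (order G)"
    using P Q by (simp_all add: sylow_subgroup_def)
  obtain g where g: "g \<in> carrier G" "\<forall>x\<in>P. cj g x \<in> Q"
    using p_subgroup_conj_into[OF p fin PG cP QG sylow_index[OF fin p Q]] unfolding cj_def by blast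
  have "cj g ` P = Q"
    using g(2) card_cj_image[OF PG g(1)] cP cQ fin subgroup.subset[OF QG] finite_subset
    by (intro card_subset_eq) auto
  then show ?thesis using g(1) by blast
qed

text \<open>Two Sylow subgroups \<open>A\<close> and \<open>B\<close> meeting in the core are
  conjugates of \<open>P\<close> by \<open>g\<close> and \<open>h\<close>; up to conjugation their
  intersection is that of \<open>P\<close> with its conjugate by
  \<open>inv h \<otimes> g\<close>.\<close>

lemma star_prop_at_conjugator:
  assumes fin: "finite (carrier G)" and p: "Factorial_Ring.prime p"
    and star: "star_prop_at G p" and P: "sylow_subgroup G p P"
  shows "\<exists>g\<in>carrier G. \<forall>a\<in>P. cj g a \<in> P \<longrightarrow> a \<in> core P"
proof -
  have PG: "subgroup P G" using P by (simp add: sylow_subgroup_def)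
  obtain A B where AB: "sylow_subgroup G p A" "sylow_subgroup G p B" "A \<inter> B = p_core G p"
    using star unfolding star_prop_at_def by blast
  obtain g where g: "g \<in> carrier G" "cj g ` P = A"
    using sylow_conjugate[OF fin p P AB(1)] by blast
  obtain h where h: "h \<in> carrier G" "cj h ` P = B"
    using sylow_conjugate[OF fin p P AB(2)] by blast
  have "a \<in> core P" if a: "a \<in> P" "cj (inv h \<otimes> g) a \<in> P" for a
  proof -
    have aG: "a \<in> carrier G" using a(1) subgroup.mem_carrier[OF PG] by blast
    have "cj g a \<in> A" using a(1) g(2) by blast
    moreover have "cj h (cj (inv h \<otimes> g) a) \<in> B" using a(2) h(2) by blast
    then have "cj g a \<in> B" using g(1) h(1) aG by (simp add: cj_cj m_assoc[symmetric])
    ultimately have core: "cj g a \<in> p_core G p" using AB(3) by blast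
    have "cj t a \<in> P" if t: "t \<in> carrier G" for t
    proof -
      \<comment> \<open>Membership in \<open>p_core\<close> is used for the Sylow subgroup chosen so
        that cancelling \<open>g\<close> leaves the desired \<open>cj t a \<in> P\<close>.\<close>
      have "cj g a \<in> cj (g \<otimes> inv t) ` P"
        using core sylow_conj_image[OF P, of "g \<otimes> inv t"] g(1) t unfolding p_core_def by blast
      then obtain b where b: "b \<in> P" "cj g a = cj (g \<otimes> inv t) b" by blast
      have bG: "b \<in> carrier G" using b(1) subgroup.mem_carrier[OF PG] by blast
      have "cj g a = cj g (cj (inv t) b)" using b(2) g(1) t bG by (simp add: cj_cj)
      then have "a = cj (inv t) b"
        using inj_onD[OF inj_on_cj[OF g(1)]] aG bG t by simp
      then show ?thesis using b(1) t bG by simp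
    qed
    then show ?thesis using aG by (simp add: core_def)
  qed
  then show ?thesis using g(1) h(1) by (intro bexI[of _ "inv h \<otimes> g"]) auto
qed

text \<open>The derived subgroup of a minimal normal \<open>V\<close> is normal, and by solvability
  different from \<open>V\<close>; minimality leaves only the trivial group.\<close>

lemma ex_abelian_minimal_normal:
  assumes fin: "finite (carrier G)" and sol: "solvable G" and nt: "carrier G \<noteq> {\<one>}"
  shows "\<exists>V. V \<lhd> G \<and> V \<noteq> {\<one>} \<and> (\<forall>v\<in>V. \<forall>w\<in>V. v \<otimes> w = w \<otimes> v) \<and>
    (\<forall>N. N \<lhd> G \<longrightarrow> N \<subseteq> V \<longrightarrow> N = {\<one>} \<or> N = V)"
proof -
  let ?A = "{N. N \<lhd> G \<and> N \<noteq> {\<one>}}"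
  have "?A \<subseteq> Pow (carrier G)" using normal_imp_subgroup subgroup.subset by blast
  then have "finite ?A" using fin by (meson finite_Pow_iff finite_subset)
  moreover have "carrier G \<in> ?A" using nt normal_self by simp
  ultimately obtain V where V: "V \<in> ?A" "\<And>N. N \<in> ?A \<Longrightarrow> N \<subseteq> V \<Longrightarrow> N = V"
    by (metis (no_types, lifting) empty_iff finite_has_minimal)
  have VN: "V \<lhd> G" "V \<noteq> {\<one>}" using V(1) by auto
  interpret V: normal V G by fact
  have dV: "derived G V \<subseteq> V" using derived_incl[OF order_refl V.subgroup_axioms] .
  have "derived G V \<noteq> V"
  proof
    assume eq: "derived G V = V"
    obtain n where n: "(derived G ^^ n) (carrier G) = {\<one>}"
      using sol solvable_imp_trivial_derived_seq unfolding solvable_def by blast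
    have "(derived G ^^ n) V = V" by (induction n) (simp_all add: eq)
    then have "V \<subseteq> {\<one>}" using mono_exp_of_derived[OF V.subset, of n] n by simp
    then show False using VN(2) V.one_closed by blast
  qed
  then have triv: "derived G V = {\<one>}" using V(2)[of "derived G V"] dV derived_is_normal[OF VN(1)] by blast
  have "v \<otimes> w = w \<otimes> v" if vw: "v \<in> V" "w \<in> V" for v w
  proof -
    have "v \<otimes> w \<otimes> inv v \<otimes> inv w \<in> derived_set G V" using vw by blast
    then have "v \<otimes> w \<otimes> inv v \<otimes> inv w \<in> derived G V" unfolding derived_def by (rule generate.incl)
    then have "(v \<otimes> w) \<otimes> inv (w \<otimes> v) = \<one>" using triv vw by (simp add: inv_mult_group m_assoc)
    then show ?thesis using mult_inv_eq_one_iff vw by simp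
  qed
  then show ?thesis using V VN by blast
qed

end

section \<open>Passing to quotients and back\<close>

lemma (in group_hom) hom_cj: "\<lbrakk>g \<in> carrier G; x \<in> carrier G\<rbrakk> \<Longrightarrow> h (G.cj g x) = H.cj (h g) (h x)"
  by (simp add: G.cj_def H.cj_def)

lemma (in group_hom) card_image_mult_card_kernel:
  assumes P: "subgroup P G" and fin: "finite P"
  shows "card (h ` P) * card (P \<inter> kernel G H h) = card P"
proof -
  note [simp] = subgroup.mem_carrier[OF P]
  have fiber: "card {x \<in> P. h x = y} = card (P \<inter> kernel G H h)" if y: "y \<in> h ` P" for y
  proof -
    obtain a where a: "a \<in> P" "y = h a" using y by blast
    have "bij_betw (\<lambda>x. a \<otimes> x) (P \<inter> kernel G H h) {x \<in> P. h x = y}"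
      by (rule bij_betw_byWitness[where f' = "\<lambda>x. inv a \<otimes> x"])
        (use a P in \<open>auto simp: kernel_def subgroup.m_closed subgroup.m_inv_closed G.m_assoc[symmetric]\<close>)
    then show ?thesis by (rule bij_betw_same_card[symmetric])
  qed
  have "P = (\<Union>y\<in>h ` P. {x \<in> P. h x = y})" by blast
  then have "card P = card (\<Union>y\<in>h ` P. {x \<in> P. h x = y})" by simp
  also have "\<dots> = (\<Sum>y\<in>h ` P. card {x \<in> P. h x = y})"
    using fin by (intro card_UN_disjoint) auto
  also have "\<dots> = card (h ` P) * card (P \<inter> kernel G H h)" using fiber by simp
  finally show ?thesis by simp
qed

text \<open>The index of \<open>P\<close> factors as \<open>t * d\<close>, with \<open>t\<close> the
  index of the image and \<open>d\<close> that of \<open>P \<inter> ?K\<close> in the kernel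
  \<open>?K\<close>. As \<open>p\<close> does not divide the product, it does not divide
  \<open>t\<close>.\<close>

lemma (in group_hom) sylow_image:
  assumes fin: "finite (carrier G)" and surj: "h ` carrier G = carrier H"
    and p: "Factorial_Ring.prime p" and P: "sylow_subgroup G p P"
  shows "sylow_subgroup H p (h ` P)"
proof -
  let ?K = "kernel G H h"
  have PG: "subgroup P G" and cP: "card P = p ^ multiplicity p (order G)"
    using P by (simp_all add: sylow_subgroup_def)
  have finH: "finite (carrier H)" using fin surj finite_imageI by metis
  have hP: "subgroup (h ` P) H" by (rule subgroup_img_is_subgroup[OF PG])
  have finP: "finite P" using fin subgroup.subset[OF PG] finite_subset by blast
  have 1: "card (h ` P) * card (P \<inter> ?K) = card P"
    by (rule card_image_mult_card_kernel[OF PG finP])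
  have "carrier G \<inter> ?K = ?K" by (auto simp: kernel_def)
  then have 2: "order H * card ?K = order G"
    using card_image_mult_card_kernel[OF G.subgroup_self fin] surj by (simp add: order_def)
  obtain t where t: "order H = card (h ` P) * t"
    using H.lagrange[OF hP] by (metis mult.commute)
  interpret K: group "G\<lparr>carrier := ?K\<rparr>" using G.subgroup_imp_group[OF subgroup_kernel] .
  have "subgroup (P \<inter> ?K) (G\<lparr>carrier := ?K\<rparr>)"
    using G.subgroups_Inter_pair[OF PG subgroup_kernel] subgroup_kernel
    by (intro G.subgroup_incl) auto
  then have "card (rcosets\<^bsub>G\<lparr>carrier := ?K\<rparr>\<^esub> (P \<inter> ?K)) * card (P \<inter> ?K) = card ?K"
    using K.lagrange by (simp add: order_def)
  then obtain d where d: "card ?K = card (P \<inter> ?K) * d" by (metis mult.commute)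
  have "order G = card P * (t * d)" using 1 2 t d by (metis mult.assoc mult.left_commute)
  moreover have "card P \<noteq> 0" using cP p by (simp add: prime_gt_0_nat)
  ultimately have "order G div card P = t * d" by simp
  then have "\<not> p dvd t" using G.sylow_index[OF fin p P] by (metis dvd_mult2)
  moreover have "card (h ` P) \<noteq> 0" using 1 \<open>card P \<noteq> 0\<close> by (metis mult_0)
  ultimately have "\<not> p dvd order H div card (h ` P)" using t by simp
  moreover have "card (h ` P) dvd p ^ multiplicity p (order G)" using 1 cP by (metis dvd_triv_left)
  then obtain k where "card (h ` P) = p ^ k" using p divides_primepow_nat by blast
  ultimately show ?thesis using H.sylow_subgroupI[OF finH p hP] by blast
qed

lemma (in group_hom) vimage_set_mult:
  assumes P: "subgroup P G" and N: "N \<subseteq> carrier H"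
  shows "{a \<in> carrier G. h a \<in> h ` P <#>\<^bsub>H\<^esub> N} = P <#> {a \<in> carrier G. h a \<in> N}"
proof
  note [simp] = subgroup.mem_carrier[OF P]
  show "{a \<in> carrier G. h a \<in> h ` P <#>\<^bsub>H\<^esub> N} \<subseteq> P <#> {a \<in> carrier G. h a \<in> N}"
  proof
    fix a assume "a \<in> {a \<in> carrier G. h a \<in> h ` P <#>\<^bsub>H\<^esub> N}"
    then obtain s v where a: "a \<in> carrier G" "s \<in> P" "v \<in> N" "h a = h s \<otimes>\<^bsub>H\<^esub> v"
      unfolding set_mult_def by blast
    then have "h (inv s \<otimes> a) = v" using N by (auto simp: H.m_assoc[symmetric])
    moreover have "a = s \<otimes> (inv s \<otimes> a)" using a by (simp add: G.m_assoc[symmetric])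
    ultimately show "a \<in> P <#> {a \<in> carrier G. h a \<in> N}"
      using a unfolding set_mult_def by (auto intro!: bexI[of _ s] exI[of _ "inv s \<otimes> a"])
  qed
  show "P <#> {a \<in> carrier G. h a \<in> N} \<subseteq> {a \<in> carrier G. h a \<in> h ` P <#>\<^bsub>H\<^esub> N}"
    unfolding set_mult_def by (auto intro!: bexI)
qed

lemma (in group_hom) vimage_core:
  assumes surj: "h ` carrier G = carrier H" and a: "a \<in> carrier G"
  shows "a \<in> G.core {a \<in> carrier G. h a \<in> Q} \<longleftrightarrow> h a \<in> H.core Q"
proof -
  have "(\<forall>g\<in>carrier G. h (G.cj g a) \<in> Q) \<longleftrightarrow> (\<forall>g\<in>carrier G. H.cj (h g) (h a) \<in> Q)"
    using a by (simp add: hom_cj)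
  also have "\<dots> \<longleftrightarrow> (\<forall>g\<in>carrier H. H.cj g (h a) \<in> Q)" unfolding surj[symmetric] by blast
  finally show ?thesis using a by (simp add: G.core_def H.core_def)
qed

text \<open>Allows the induction to be stated with preimages in a fixed group while each step is
  carried out in a quotient.\<close>

lemma (in group_hom) vimage_core_conjugator:
  assumes surj: "h ` carrier G = carrier H" and Q: "\<And>i. i \<in> I \<Longrightarrow> Q i \<subseteq> carrier H" and x: "x \<in> carrier G"
  shows "G.core_conjugator I (\<lambda>i. {a \<in> carrier G. h a \<in> Q i}) x \<longleftrightarrow> H.core_conjugator I Q (h x)"
proof -
  have "(\<forall>a\<in>{a \<in> carrier G. h a \<in> Q i}. G.cj x a \<in> {a \<in> carrier G. h a \<in> Q i} \<longrightarrow>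
        a \<in> G.core {a \<in> carrier G. h a \<in> Q i}) \<longleftrightarrow>
      (\<forall>a\<in>Q i. H.cj (h x) a \<in> Q i \<longrightarrow> a \<in> H.core (Q i))" (is "?L \<longleftrightarrow> ?R") if i: "i \<in> I" for i
  proof -
    have "?L \<longleftrightarrow> (\<forall>a\<in>carrier G. h a \<in> Q i \<longrightarrow> H.cj (h x) (h a) \<in> Q i \<longrightarrow> h a \<in> H.core (Q i))"
      using vimage_core[OF surj] x by (auto simp: hom_cj)
    also have "\<dots> \<longleftrightarrow> (\<forall>b\<in>h ` carrier G. b \<in> Q i \<longrightarrow> H.cj (h x) b \<in> Q i \<longrightarrow> b \<in> H.core (Q i))"
      by blast
    finally show ?thesis using Q[OF i] unfolding surj by blast
  qed
  then show ?thesis using x by (simp add: G.core_conjugator_def H.core_conjugator_def)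
qed

lemma (in group) set_mult_one: "P \<subseteq> carrier G \<Longrightarrow> P <#> {\<one>} = P"
  by (force simp: set_mult_def)

lemma (in group) conj_subgroup_eq:
  assumes "P \<subseteq> carrier G" "g \<in> carrier G"
  shows "P \<inter> conj_subgroup G P g = {a \<in> P. cj g a \<in> P}"
proof -
  have "conj_subgroup G P g = cj (inv g) ` P"
    using assms by (auto simp: conj_subgroup_def l_coset_def r_coset_def cj_def image_iff)
  moreover have "a \<in> cj (inv g) ` P \<longleftrightarrow> cj g a \<in> P" if "a \<in> P" for a
  proof
    assume "a \<in> cj (inv g) ` P"
    then obtain b where "b \<in> P" "a = cj (inv g) b" by blast
    then show "cj g a \<in> P" using assms by auto
  next
    assume "cj g a \<in> P"
    moreover have "a = cj (inv g) (cj g a)" using that assms by auto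
    ultimately show "a \<in> cj (inv g) ` P" by blast
  qed
  ultimately show ?thesis by blast
qed

text \<open>Downward induction on normal subgroups: for a maximal counterexample \<open>M\<close>, a
  minimal normal subgroup \<open>V\<close> of the quotient by \<open>M\<close> has a strictly larger
  preimage \<open>?L\<close>, where a conjugator exists and can be lifted.\<close>

lemma (in group) simultaneous_conjugator:
  fixes p :: "'i \<Rightarrow> nat" and P :: "'i \<Rightarrow> 'a set"
  assumes fin: "finite (carrier G)" and sol: "solvable G"
    and star: "\<And>N. N \<lhd> G \<Longrightarrow> star_prop (G Mod N)"
    and I: "finite I" and p: "\<And>i. i \<in> I \<Longrightarrow> Factorial_Ring.prime (p i)" "inj_on p I"
    and P: "\<And>i. i \<in> I \<Longrightarrow> sylow_subgroup G (p i) (P i)" and K: "K \<lhd> G"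
  shows "\<exists>x. core_conjugator I (\<lambda>i. P i <#> K) x"
    (is "?good K")
proof (rule ccontr)
  assume "\<not> ?good K"
  let ?A = "{K. K \<lhd> G \<and> \<not> ?good K}"
  have "?A \<subseteq> Pow (carrier G)" using normal_imp_subgroup subgroup.subset by blast
  then have "finite ?A" using fin by (meson finite_Pow_iff finite_subset)
  moreover have "K \<in> ?A" using K \<open>\<not> ?good K\<close> by blast
  ultimately obtain M where M: "M \<in> ?A" "\<And>L. L \<in> ?A \<Longrightarrow> M \<subseteq> L \<Longrightarrow> L = M"
    by (metis (no_types, lifting) empty_iff finite_has_maximal)
  have MN: "M \<lhd> G" and nM: "\<not> ?good M" using M(1) by blast+
  interpret M: normal M G by fact
  have PG: "subgroup (P i) G" if "i \<in> I" for i using P[OF that] by (simp add: sylow_subgroup_def)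
  \<comment> \<open>Start of the induction: for the whole group every product is the full carrier,
    and the neutral element serves.\<close>
  have "M \<noteq> carrier G"
  proof
    assume "M = carrier G"
    moreover have "P i <#> carrier G = carrier G" if "i \<in> I" for i
      using PG[OF that] by (metis commut_normal normal_self set_mult_carrier_idem)
    ultimately have "core_conjugator I (\<lambda>i. P i <#> M) \<one>" by (simp add: core_conjugator_def core_def)
    then show False using nM by blast
  qed
  let ?H = "G Mod M" and ?h = "\<lambda>x. M #> x"
  interpret H: group ?H by (rule M.factorgroup_is_group)
  interpret h: group_hom G ?H ?h
    using M.r_coset_hom_Mod by unfold_locales
  have surj: "?h ` carrier G = carrier ?H" by (simp add: carrier_FactGroup)
  have kernel: "{a \<in> carrier G. ?h a \<in> {\<one>\<^bsub>?H\<^esub>}} = M"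
    using coset_join1[OF _ _ M.subgroup_axioms] coset_join2[OF _ M.subgroup_axioms] M.subset
    by auto
  have h_M: "?h a = \<one>\<^bsub>?H\<^esub> \<longleftrightarrow> a \<in> M" if "a \<in> carrier G" for a
    using that kernel by blast
  have finH: "finite (carrier ?H)" unfolding surj[symmetric] using fin by (rule finite_imageI)
  have "carrier ?H \<noteq> {\<one>\<^bsub>?H\<^esub>}"
  proof
    assume eq: "carrier ?H = {\<one>\<^bsub>?H\<^esub>}"
    have "a \<in> M" if a: "a \<in> carrier G" for a
    proof -
      have "?h a \<in> {\<one>\<^bsub>?H\<^esub>}" unfolding eq[symmetric] using a by (rule h.hom_closed)
      then show ?thesis using h_M[OF a] by blast
    qed
    then show False using \<open>M \<noteq> carrier G\<close> M.subset by blast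
  qed
  from H.ex_abelian_minimal_normal[OF finH h.surj_hom_imp_solvable[OF surj sol] this]
  obtain V where V': "V \<lhd> ?H" "V \<noteq> {\<one>\<^bsub>?H\<^esub>}"
    "\<forall>v\<in>V. \<forall>w\<in>V. v \<otimes>\<^bsub>?H\<^esub> w = w \<otimes>\<^bsub>?H\<^esub> v"
    "\<forall>N. N \<lhd> ?H \<longrightarrow> N \<subseteq> V \<longrightarrow> N = {\<one>\<^bsub>?H\<^esub>} \<or> N = V"
    by (elim exE conjE)
  note V = V'(1,2) V'(3,4)[rule_format]
  interpret V: normal V ?H by fact
  let ?L = "{a \<in> carrier G. ?h a \<in> V}"
  have "?L \<lhd> G"
  proof (rule normalI_cj)
    show "subgroup ?L G"
    proof (rule subgroupI)
      have "?h \<one> \<in> V" unfolding h.hom_one by (rule V.one_closed)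
      then show "?L \<noteq> {}" by blast
    qed (auto simp: h.hom_mult h.hom_inv V.m_closed V.m_inv_closed
        simp del: mult_FactGroup one_FactGroup)
    show "cj g x \<in> ?L" if "g \<in> carrier G" "x \<in> ?L" for g x
      using that H.normal_cj[OF V(1)] by (simp add: h.hom_cj)
  qed
  moreover have "M \<subseteq> ?L"
  proof
    fix a assume a: "a \<in> M"
    have aG: "a \<in> carrier G" by (rule M.mem_carrier[OF a])
    have "?h a = \<one>\<^bsub>?H\<^esub>" by (rule iffD2[OF h_M[OF aG] a])
    then have "?h a \<in> V" using V.one_closed by (simp only:)
    then show "a \<in> ?L" using aG by (intro CollectI conjI)
  qed
  moreover have "?L \<noteq> M"
  proof
    assume "?L = M"
    have "v = \<one>\<^bsub>?H\<^esub>" if v: "v \<in> V" for v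
    proof -
      have "v \<in> ?h ` carrier G" unfolding surj using v by (rule V.mem_carrier)
      then obtain a where a: "v = ?h a" "a \<in> carrier G" by (elim imageE)
      have "a \<in> ?L" using a(2) v unfolding a(1) by (intro CollectI conjI)
      then have "a \<in> M" by (simp only: \<open>?L = M\<close>)
      then show ?thesis unfolding a(1) by (rule iffD2[OF h_M[OF a(2)]])
    qed
    then show False using V(2) V.one_closed by blast
  qed
  ultimately obtain x where x: "core_conjugator I (\<lambda>i. P i <#> ?L) x" using M(2)[of ?L] by blast
  have sylow: "sylow_subgroup ?H (p i) (?h ` P i)" if "i \<in> I" for i
    by (rule h.sylow_image[OF fin surj p(1)[OF that] P[OF that]])
  have hPG: "subgroup (?h ` P i) ?H" if "i \<in> I" for i
    using sylow[OF that] by (simp add: sylow_subgroup_def)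
  have vL: "{a \<in> carrier G. ?h a \<in> ?h ` P i <#>\<^bsub>?H\<^esub> V} = P i <#> ?L" if "i \<in> I" for i
    by (rule h.vimage_set_mult[OF PG[OF that] V.subset])
  \<comment> \<open>The product formula for preimages with trivial second factor, whose preimage is
    \<open>M\<close>.\<close>
  have vM: "{a \<in> carrier G. ?h a \<in> ?h ` P i} = P i <#> M" if "i \<in> I" for i
  proof -
    have "?h ` P i <#>\<^bsub>?H\<^esub> {\<one>\<^bsub>?H\<^esub>} = ?h ` P i"
      by (rule H.set_mult_one[OF subgroup.subset[OF hPG[OF that]]])
    moreover have "{\<one>\<^bsub>?H\<^esub>} \<subseteq> carrier ?H" using H.one_closed by simp
    ultimately show ?thesis
      using h.vimage_set_mult[OF PG[OF that], of "{\<one>\<^bsub>?H\<^esub>}"] kernel by (simp only:)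
  qed
  have sub: "?h ` P i <#>\<^bsub>?H\<^esub> V \<subseteq> carrier ?H" if "i \<in> I" for i
    by (rule H.setmult_subset_G[OF subgroup.subset[OF hPG[OF that]] V.subset])
  have "\<exists>y. H.core_conjugator I (\<lambda>i. ?h ` P i) y"
  proof (rule H.lift_simultaneous_conjugator[OF finH V(1,3,2,4) I p])
    fix i assume i: "i \<in> I"
    show "subgroup (?h ` P i) ?H" by (rule hPG[OF i])
    show "card (?h ` P i) = p i ^ multiplicity (p i) (order ?H)"
      using sylow[OF i] by (simp add: sylow_subgroup_def)
    show "\<not> p i dvd order ?H div card (?h ` P i)"
      by (rule H.sylow_index[OF finH p(1)[OF i] sylow[OF i]])
    have "star_prop_at ?H (p i)" using star[OF MN] p(1)[OF i] unfolding star_prop_def by blast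
    then show "\<exists>g\<in>carrier ?H. \<forall>a\<in>?h ` P i. H.cj g a \<in> ?h ` P i \<longrightarrow> a \<in> H.core (?h ` P i)"
      by (rule H.star_prop_at_conjugator[OF finH p(1)[OF i] _ sylow[OF i]])
  next
    have xG: "x \<in> carrier G" using x by (simp add: core_conjugator_def)
    have "core_conjugator I (\<lambda>i. {a \<in> carrier G. ?h a \<in> ?h ` P i <#>\<^bsub>?H\<^esub> V}) =
        core_conjugator I (\<lambda>i. P i <#> ?L)"
      by (rule core_conjugator_cong) (rule vL)
    then have "core_conjugator I (\<lambda>i. {a \<in> carrier G. ?h a \<in> ?h ` P i <#>\<^bsub>?H\<^esub> V}) x"
      using x by (simp only:)
    then show "\<exists>y. H.core_conjugator I (\<lambda>i. ?h ` P i <#>\<^bsub>?H\<^esub> V) y"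
      using h.vimage_core_conjugator[where Q = "\<lambda>i. ?h ` P i <#>\<^bsub>?H\<^esub> V", OF surj sub xG]
      by (intro exI[of _ "?h x"]) (simp only:)
  qed
  then obtain y where y: "H.core_conjugator I (\<lambda>i. ?h ` P i) y" by blast
  then have "y \<in> ?h ` carrier G" unfolding surj H.core_conjugator_def by blast
  then obtain z where z: "y = ?h z" "z \<in> carrier G" by (elim imageE)
  have "core_conjugator I (\<lambda>i. {a \<in> carrier G. ?h a \<in> ?h ` P i}) z"
    using y h.vimage_core_conjugator[where Q = "\<lambda>i. ?h ` P i", OF surj subgroup.subset[OF hPG] z(2)]
    by (simp only: z(1))
  moreover have "core_conjugator I (\<lambda>i. {a \<in> carrier G. ?h a \<in> ?h ` P i}) =
      core_conjugator I (\<lambda>i. P i <#> M)"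
    by (rule core_conjugator_cong) (rule vM)
  ultimately have "core_conjugator I (\<lambda>i. P i <#> M) z" by (simp only:)
  then show False using nM by blast
qed

theorem theorem1p1:
  fixes G :: "('a, 'b) monoid_scheme" and n :: nat
    and p :: "nat \<Rightarrow> nat" and P :: "nat \<Rightarrow> 'a set"
  assumes "group G" and "finite (carrier G)" and "solvable G"
    and "\<And>N. N \<lhd> G \<Longrightarrow> star_prop (G Mod N)"
    and "\<And>i. i \<in> {1..n} \<Longrightarrow> Factorial_Ring.prime (p i)" and "inj_on p {1..n}"
    and "\<And>i. i \<in> {1..n} \<Longrightarrow> sylow_subgroup G (p i) (P i)"
  shows "\<exists>x\<in>carrier G. \<forall>i\<in>{1..n}.
    inclusion_minimal (P i \<inter> conj_subgroup G (P i) x)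
      {P i \<inter> conj_subgroup G (P i) g | g. g \<in> carrier G}"
proof -
  interpret group G by fact
  have PG: "subgroup (P i) G" if "i \<in> {1..n}" for i
    using assms(7)[OF that] by (simp add: sylow_subgroup_def)
  have "P i <#>\<^bsub>G\<^esub> {\<one>\<^bsub>G\<^esub>} = P i" if "i \<in> {1..n}" for i
    by (rule set_mult_one[OF subgroup.subset[OF PG[OF that]]])
  then obtain x where x: "x \<in> carrier G"
    "\<And>i a. \<lbrakk>i \<in> {1..n}; a \<in> P i; cj x a \<in> P i\<rbrakk> \<Longrightarrow> a \<in> core (P i)"
    using simultaneous_conjugator[OF assms(2-4) finite_atLeastAtMost assms(5-7) one_is_normal]
    by (auto simp: core_conjugator_def)
  have "inclusion_minimal (P i \<inter> conj_subgroup G (P i) x)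
      {P i \<inter> conj_subgroup G (P i) g | g. g \<in> carrier G}" if i: "i \<in> {1..n}" for i
  proof -
    \<comment> \<open>The intersection for \<open>x\<close> lies in the core and hence in every
      other intersection: it is even the least one.\<close>
    have "P i \<inter> conj_subgroup G (P i) x \<subseteq> P i \<inter> conj_subgroup G (P i) g" if "g \<in> carrier G" for g
      using x(2)[OF i] that x(1) conj_subgroup_eq[OF subgroup.subset[OF PG[OF i]]]
      by (auto simp: core_def)
    then show ?thesis using x(1) unfolding inclusion_minimal_def by blast
  qed
  then show ?thesis using x(1) by blast
qed

end
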